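(* Let $\mathcal C\subset\mathbb{RP}^2$ be a non-degenerate cubic that is the isogonal cubic of some quadrilateral with vertices in $\mathbb R^2$. Then for any point $X\in\mathcal C$ there is only one possible point $X'\in\mathcal C$ which can be the isogonal conjugate of $X$: if $\mathcal C$ is the isogonal cubic of $ABCD$ and also of $A_1B_1C_1D_1$ (all vertices in $\mathbb R^2$), then the isogonal conjugate of $X$ in $ABCD$ equals the isogonal conjugate of $X$ in $A_1B_1C_1D_1$.
   Context: A cubic is non-degenerate if it is irreducible. Quadrilaterals have distinct vertices but may be self-intersecting, and some vertices may be collinear. Isogonality: pairs of lines $(XA,XC)$, $(XB,XD)$ through a point $X\in\mathbb R^2$ are isogonal if they have the same pair of angle bisectors. If $X$ is a real point at infinity, they are isogonal if for every line meeting $XA,XB,XC,XD$ at finite points $E,F,G,H$ the directed lengths $EF$ and $HG$ are equal (i.e. the parallel lines $XA,XC$ have the same midline as $XB,XD$). The isogonal cubic of $ABCD$ is the locus of points $X\in\mathbb{RP}^2$ for which $(XA,XC)$ and $(XB,XD)$ are isogonal; identifying $\mathbb R^2$ with the complex plane, with lower-case letters for complex coordinates, its equation is $(x-b)(x-d)\,\overline{(x-a)(x-c)}=\overline{(x-b)(x-d)}\,(x-a)(x-c)$, completed projectively. Points $X,X'$ are isogonal conjugates in $ABCD$ if $(AX,AX')$ and $(AB,AD)$ are isogonal and the analogous condition holds at the other vertices $B,C,D$ (each with its two neighbouring vertices). Here, for a point $U\in\mathcal C$, $UU$ denotes the tangent to $\mathcal C$ at $U$; with this convention $A,C$ are isogonal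 conjugates, and so are $B,D$. Every point of the isogonal cubic has a unique isogonal conjugate in $ABCD$, which lies on the cubic. *)

theory Defs
  imports "HOL-Analysis.Analysis" "HOL-Computational_Algebra.Polynomial"
begin

section \<open>The real projective plane\<close>

text \<open>
  \<open>\<real>\<^sup>2\<close> is identified with \<open>complex\<close>, and the real projective plane is the set of
  one-dimensional subspaces of \<open>complex \<times> real\<close>, i.e. \<open>(w, t)\<close> are the homogeneous coordinates
  \<open>[Re w : Im w : t]\<close>. The points at infinity are those with \<open>t = 0\<close>, and projective lines are
  the two-dimensional subspaces.
\<close>

definition RP2 :: "(complex \<times> real) set set" where
  "RP2 = {P. subspace P \<and> dim P = 1}"

definition fin_pt :: "complex \<Rightarrow> (complex \<times> real) set" where
  "fin_pt z = span {(z, 1)}"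

definition line_through :: "(complex \<times> real) set \<Rightarrow> (complex \<times> real) set \<Rightarrow> (complex \<times> real) set" where
  "line_through P Q = span (P \<union> Q)"

definition affine_part :: "(complex \<times> real) set \<Rightarrow> complex set" where
  "affine_part L = {z. (z, 1) \<in> L}"

definition zero_locus :: "(complex \<times> real \<Rightarrow> real) \<Rightarrow> (complex \<times> real) set set" where
  "zero_locus F = {P \<in> RP2. \<forall>v\<in>P. F v = 0}"


section \<open>Non-degenerate cubics\<close>

text \<open>
  Elements of \<open>\<real>[X, Y, Z]\<close> are nested univariate polynomials: the coefficient of
  \<open>X\<^sup>i Y\<^sup>j Z\<^sup>k\<close> in \<open>F\<close> is \<open>coeff (coeff (coeff F i) j) k\<close>.
  For a real cubic form, irreducibility over the reals and over the complex numbers agree: a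
  non-real linear factor comes with its conjugate, and the cofactor is a real linear form.
\<close>

definition homogeneous :: "nat \<Rightarrow> real poly poly poly \<Rightarrow> bool" where
  "homogeneous m F \<longleftrightarrow> (\<forall>i j k. coeff (coeff (coeff F i) j) k \<noteq> 0 \<longrightarrow> i + j + k = m)"

definition eval3 :: "real poly poly poly \<Rightarrow> complex \<times> real \<Rightarrow> real" where
  "eval3 F = (\<lambda>(w, t). poly (poly (poly F [:[:Re w:]:]) [:Im w:]) t)"

definition nondegenerate_cubic :: "(complex \<times> real) set set \<Rightarrow> bool" where
  "nondegenerate_cubic K \<longleftrightarrow> (\<exists>F. homogeneous 3 F \<and> irreducible F \<and> K = zero_locus (eval3 F))"


section \<open>Isogonal pairs of lines\<close>

definition line_reflection :: "complex set \<Rightarrow> complex \<Rightarrow> complex" where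
  "line_reflection n z = 2 * closest_point n z - z"

text \<open>
  The reflection condition also covers coincident lines, whose angle bisectors are the line
  itself and its perpendicular.
\<close>

definition angle_bisectors :: "complex \<Rightarrow> complex set \<Rightarrow> complex set \<Rightarrow> complex set set" where
  "angle_bisectors x l l' =
     {n. affine n \<and> aff_dim n = 1 \<and> x \<in> n \<and> line_reflection n ` l = l'}"

definition isogonal :: "complex \<Rightarrow> complex set \<Rightarrow> complex set \<Rightarrow> complex set \<Rightarrow> complex set \<Rightarrow> bool" where
  "isogonal x l l' m m' \<longleftrightarrow> angle_bisectors x l l' = angle_bisectors x m m'"

definition isogonal_at_infinity ::
    "complex set \<Rightarrow> complex set \<Rightarrow> complex set \<Rightarrow> complex set \<Rightarrow> bool" where
  "isogonal_at_infinity l l' m m' \<longleftrightarrow>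
     (\<forall>n e f g h. affine n \<and> aff_dim n = 1 \<and>
        n \<inter> l = {e} \<and> n \<inter> m = {f} \<and> n \<inter> l' = {g} \<and> n \<inter> m' = {h} \<longrightarrow> f - e = g - h)"


section \<open>The isogonal cubic\<close>

definition quadrilateral :: "complex \<Rightarrow> complex \<Rightarrow> complex \<Rightarrow> complex \<Rightarrow> bool" where
  "quadrilateral a b c d \<longleftrightarrow> distinct [a, b, c, d]"

text \<open>
  Homogenising \<open>(x - b)(x - d) cnj ((x - a)(x - c)) = cnj ((x - b)(x - d)) (x - a)(x - c)\<close> in
  degree 4 with \<open>x = w / t\<close>, both sides have the term \<open>\<bar>w\<bar>\<^sup>4\<close>, so the difference is divisible
  by \<open>t\<close>. The form below is the quotient, up to the factor \<open>2 \<i>\<close>; see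
  \<open>isogonal_form_completion\<close>.
\<close>

definition isogonal_form ::
    "complex \<Rightarrow> complex \<Rightarrow> complex \<Rightarrow> complex \<Rightarrow> complex \<times> real \<Rightarrow> real" where
  "isogonal_form a b c d = (\<lambda>(w, t).
     let r = (b + d) * w - b * d * of_real t;
         s = (a + c) * w - a * c * of_real t
     in Im (of_real t * r * cnj s - r * cnj (w\<^sup>2) - w\<^sup>2 * cnj s))"

definition isogonal_cubic ::
    "complex \<Rightarrow> complex \<Rightarrow> complex \<Rightarrow> complex \<Rightarrow> (complex \<times> real) set set" where
  "isogonal_cubic a b c d = zero_locus (isogonal_form a b c d)"


section \<open>Isogonal conjugates\<close>

definition tangent_line ::
    "(complex \<times> real \<Rightarrow> real) \<Rightarrow> complex \<times> real \<Rightarrow> (complex \<times> real) set" where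
  "tangent_line F u = {v. frechet_derivative F (at u) v = 0}"

text \<open>
  The line joining the vertex \<open>u\<close> to the point \<open>X\<close>, read as the tangent to the isogonal cubic
  if \<open>X\<close> is \<open>u\<close> itself. The vertices are always smooth points of the cubic.
\<close>

definition vertex_line ::
    "complex \<Rightarrow> complex \<Rightarrow> complex \<Rightarrow> complex \<Rightarrow> complex \<Rightarrow> (complex \<times> real) set \<Rightarrow> complex set" where
  "vertex_line a b c d u X = affine_part
     (if X = fin_pt u then tangent_line (isogonal_form a b c d) (u, 1)
      else line_through (fin_pt u) X)"

definition isogonal_conjugates ::
    "complex \<Rightarrow> complex \<Rightarrow> complex \<Rightarrow> complex \<Rightarrow>
     (complex \<times> real) set \<Rightarrow> (complex \<times> real) set \<Rightarrow> bool" where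
  "isogonal_conjugates a b c d X X' \<longleftrightarrow> X \<in> RP2 \<and> X' \<in> RP2 \<and>
     (let L = vertex_line a b c d in
        isogonal a (L a X) (L a X') (L a (fin_pt b)) (L a (fin_pt d)) \<and>
        isogonal b (L b X) (L b X') (L b (fin_pt a)) (L b (fin_pt c)) \<and>
        isogonal c (L c X) (L c X') (L c (fin_pt b)) (L c (fin_pt d)) \<and>
        isogonal d (L d X) (L d X') (L d (fin_pt c)) (L d (fin_pt a)))"


section \<open>The isogonal cubic as a locus\<close>

lemma isogonal_form_completion:
  "2 * \<i> * of_real (t * isogonal_form a b c d (w, t)) =
     (w - b * of_real t) * (w - d * of_real t) * cnj ((w - a * of_real t) * (w - c * of_real t)) -
     cnj ((w - b * of_real t) * (w - d * of_real t)) * ((w - a * of_real t) * (w - c * of_real t))"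
  by (simp add: complex_eq_iff isogonal_form_def Let_def power2_eq_square algebra_simps)

lemma isogonal_form_scale: "isogonal_form a b c d (k *\<^sub>R v) = k ^ 3 * isogonal_form a b c d v"
  by (cases v) (simp add: isogonal_form_def Let_def power2_eq_square power3_eq_cube
      scaleR_conv_of_real algebra_simps)

lemma dim_span_singleton: "v \<noteq> 0 \<Longrightarrow> dim (span {v}) = 1"
  for v :: "'a::euclidean_space"
  by (simp add: dim_span)

lemma span_in_isogonal_cubic:
  assumes "v \<noteq> 0"
  shows "span {v} \<in> isogonal_cubic a b c d \<longleftrightarrow> isogonal_form a b c d v = 0"
proof -
  have "(\<forall>u\<in>span {v}. isogonal_form a b c d u = 0) \<longleftrightarrow> isogonal_form a b c d v = 0"
    by (auto simp: span_singleton isogonal_form_scale simp del: scaleR_Pair)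
  then show ?thesis
    by (simp add: isogonal_cubic_def zero_locus_def RP2_def dim_span_singleton assms del: dim_span)
qed

lemma isogonal_cubic_finite:
  "fin_pt x \<in> isogonal_cubic a b c d \<longleftrightarrow>
     (x - b) * (x - d) * cnj ((x - a) * (x - c)) = cnj ((x - b) * (x - d)) * ((x - a) * (x - c))"
  using isogonal_form_completion[of 1 a b c d x]
  by (auto simp: fin_pt_def span_in_isogonal_cubic zero_prod_def)

definition line_dir :: "complex \<Rightarrow> complex \<Rightarrow> complex set" where
  "line_dir x u = range (\<lambda>k::real. x + of_real k * u)"

lemma line_dir_eq: "u \<noteq> 0 \<Longrightarrow> z \<in> line_dir x u \<longleftrightarrow> Im ((z - x) * cnj u) = 0"
proof
  assume u: "u \<noteq> 0" and im: "Im ((z - x) * cnj u) = 0"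
  have "(z - x) * cnj u = of_real (Re ((z - x) * cnj u))"
    using im by (simp add: complex_eq_iff)
  then have "(z - x) * cnj u * u = of_real (Re ((z - x) * cnj u)) * u"
    by (rule arg_cong)
  moreover have "u * cnj u \<noteq> 0" using u by simp
  ultimately have "z - x = of_real (Re ((z - x) * cnj u)) * u / (u * cnj u)"
    by (metis (no_types, lifting) mult.assoc mult.commute nonzero_eq_divide_eq)
  then have "z = x + of_real (Re ((z - x) * cnj u) / (cmod u)\<^sup>2) * u"
    unfolding of_real_divide complex_norm_square
    by (simp only: times_divide_eq_left diff_eq_eq add.commute)
  then show "z \<in> line_dir x u" unfolding line_dir_def by blast
qed (auto simp: line_dir_def)

lemma line_dir_dir:
  assumes "u \<noteq> 0" "v \<noteq> 0"
  shows "line_dir x u = line_dir x v \<longleftrightarrow> Im (u * cnj v) = 0"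
proof
  assume "line_dir x u = line_dir x v"
  moreover have "x + u \<in> line_dir x u" using assms by (simp add: line_dir_eq)
  ultimately show "Im (u * cnj v) = 0" using assms by (simp add: line_dir_eq)
next
  assume "Im (u * cnj v) = 0"
  then have "u \<in> line_dir 0 v" using assms by (simp add: line_dir_eq)
  then obtain k :: real where k: "u = of_real k * v" by (auto simp: line_dir_def)
  then have "k \<noteq> 0" using assms by auto
  show "line_dir x u = line_dir x v"
  proof -
    have "x + of_real l * u = x + of_real (l * k) * v" for l :: real by (simp add: k)
    moreover have "x + of_real l * v = x + of_real (l / k) * u" for l :: real
      using \<open>k \<noteq> 0\<close> by (simp add: k)
    ultimately show ?thesis unfolding line_dir_def by blast
  qed
qed

lemma affine_line_dir: "affine (line_dir x u)"
  unfolding affine_def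
proof (intro ballI allI impI)
  fix y z and p q :: real assume "y \<in> line_dir x u" "z \<in> line_dir x u" and pq: "p + q = 1"
  then obtain k l :: real where "y = x + of_real k * u" "z = x + of_real l * u"
    by (auto simp: line_dir_def)
  moreover from pq have "q = 1 - p" by simp
  ultimately have "p *\<^sub>R y + q *\<^sub>R z = x + of_real (p * k + q * l) * u"
    by (simp add: scaleR_conv_of_real ring_distribs)
  then show "p *\<^sub>R y + q *\<^sub>R z \<in> line_dir x u" unfolding line_dir_def by blast
qed

lemma line_dir_affine_hull: "line_dir x u = affine hull {x, x + u}"
proof -
  have "(\<exists>p q. z = p *\<^sub>R x + q *\<^sub>R (x + u) \<and> p + q = 1) \<longleftrightarrow> z \<in> line_dir x u" for z
  proof
    assume "\<exists>p q. z = p *\<^sub>R x + q *\<^sub>R (x + u) \<and> p + q = 1"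
    then obtain p q where z: "z = p *\<^sub>R x + q *\<^sub>R (x + u)" and "p + q = 1" by blast
    then have "p = 1 - q" by simp
    then have "z = x + of_real q * u" using z by (simp add: scaleR_conv_of_real ring_distribs)
    then show "z \<in> line_dir x u" unfolding line_dir_def by blast
  next
    assume "z \<in> line_dir x u"
    then obtain q :: real where "z = x + of_real q * u" by (auto simp: line_dir_def)
    then have "z = (1 - q) *\<^sub>R x + q *\<^sub>R (x + u)" by (simp add: scaleR_conv_of_real algebra_simps)
    then show "\<exists>p q. z = p *\<^sub>R x + q *\<^sub>R (x + u) \<and> p + q = 1" by (metis diff_add_cancel)
  qed
  then show ?thesis by (auto simp: affine_hull_2)
qed

lemma affine_line_iff:
  "affine n \<and> aff_dim n = 1 \<and> x \<in> n \<longleftrightarrow> (\<exists>u. u \<noteq> 0 \<and> n = line_dir x u)"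
proof
  assume n: "affine n \<and> aff_dim n = 1 \<and> x \<in> n"
  then have "n \<noteq> {x}" by auto
  then obtain y where y: "y \<in> n" "y \<noteq> x" using n by blast
  have "affine hull {x, y} = n"
    using n y by (intro affine_dim_equal) (auto simp: hull_minimal subset_hull)
  then have "n = line_dir x (y - x)" by (simp add: line_dir_affine_hull)
  then show "\<exists>u. u \<noteq> 0 \<and> n = line_dir x u" using y by (intro exI[of _ "y - x"]) auto
next
  assume "\<exists>u. u \<noteq> 0 \<and> n = line_dir x u"
  then show "affine n \<and> aff_dim n = 1 \<and> x \<in> n"
    by (auto simp: line_dir_affine_hull aff_dim_2 hull_inc)
qed

lemma line_reflection_line_dir:
  assumes "u \<noteq> 0"
  shows "line_reflection (line_dir x u) (x + w) = x + u * cnj w / cnj u"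
proof -
  let ?p = "x + of_real (Re (w * cnj u) / (cmod u)\<^sup>2) * u"
  have "?p = closest_point (line_dir x u) (x + w)"
  proof (rule closest_point_unique)
    show "convex (line_dir x u)" by (simp add: affine_imp_convex affine_line_dir)
    show "closed (line_dir x u)" unfolding line_dir_affine_hull by simp
    show "?p \<in> line_dir x u" unfolding line_dir_def by blast
    show "\<forall>z\<in>line_dir x u. dist (x + w) ?p \<le> dist (x + w) z"
    proof
      fix z assume "z \<in> line_dir x u"
      then obtain k :: real where z: "z = x + of_real k * u" by (auto simp: line_dir_def)
      define l where "l = Re (w * cnj u) / (cmod u)\<^sup>2"
      have l: "l * (u \<bullet> u) = w \<bullet> u"
        using assms by (simp add: l_def dot_square_norm) (simp add: inner_complex_def)
      have "orthogonal (w - l *\<^sub>R u) ((l - k) *\<^sub>R u)"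
        using l by (simp add: orthogonal_def inner_diff_left)
      then have "(norm (w - l *\<^sub>R u + (l - k) *\<^sub>R u))\<^sup>2
          = (norm (w - l *\<^sub>R u))\<^sup>2 + (norm ((l - k) *\<^sub>R u))\<^sup>2"
        by (rule norm_add_Pythagorean)
      then have "(norm (w - l *\<^sub>R u))\<^sup>2 \<le> (norm (w - k *\<^sub>R u))\<^sup>2"
        by (simp add: scaleR_left_diff_distrib)
      then have "norm (w - l *\<^sub>R u) \<le> norm (w - k *\<^sub>R u)" by simp
      then show "dist (x + w) ?p \<le> dist (x + w) z"
        unfolding z l_def dist_norm by (simp add: scaleR_conv_of_real)
    qed
  qed
  then have "line_reflection (line_dir x u) (x + w) = 2 * ?p - (x + w)"
    by (simp add: line_reflection_def)
  also have "2 * of_real (Re (w * cnj u) / (cmod u)\<^sup>2) * u - w = u * cnj w / cnj u"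
  proof -
    have "2 * complex_of_real (Re (w * cnj u)) = w * cnj u + cnj w * u"
      by (simp add: complex_eq_iff)
    moreover have "complex_of_real ((cmod u)\<^sup>2) = u * cnj u"
      by (metis complex_norm_square)
    ultimately show ?thesis using assms
      by (simp add: field_simps del: of_real_power)
  qed
  then have "2 * ?p - (x + w) = x + u * cnj w / cnj u" by (simp add: algebra_simps)
  finally show ?thesis .
qed

lemma angle_bisectors_line_dir:
  assumes "u \<noteq> 0" "v \<noteq> 0"
  shows "angle_bisectors x (line_dir x u) (line_dir x v) =
           {line_dir x n | n. n \<noteq> 0 \<and> Im (u * v * cnj (n\<^sup>2)) = 0}"
proof -
  have img: "line_reflection (line_dir x n) ` line_dir x u = line_dir x (n * cnj u / cnj n)"
    if "n \<noteq> 0" for n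
  proof -
    have "line_reflection (line_dir x n) (x + of_real k * u) = x + of_real k * (n * cnj u / cnj n)"
      for k :: real
      using line_reflection_line_dir[OF that, of x "of_real k * u"] by simp
    then show ?thesis unfolding line_dir_def[of x u] line_dir_def[of x "n * cnj u / cnj n"]
      by (simp add: image_image)
  qed
  have bis: "line_reflection (line_dir x n) ` line_dir x u = line_dir x v \<longleftrightarrow> Im (u * v * cnj (n\<^sup>2)) = 0"
    if n: "n \<noteq> 0" for n
  proof -
    have "n * cnj u / cnj n * cnj v = cnj (u * v * cnj (n\<^sup>2)) / of_real ((cmod n)\<^sup>2)"
      using n unfolding complex_norm_square by (simp add: power2_eq_square field_simps)
    then have "Im (n * cnj u / cnj n * cnj v) = - Im (u * v * cnj (n\<^sup>2)) / (cmod n)\<^sup>2"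
      by (simp only: Im_divide_of_real cnj.sel)
    then have "Im (n * cnj u / cnj n * cnj v) = 0 \<longleftrightarrow> Im (u * v * cnj (n\<^sup>2)) = 0"
      using n by (simp only: divide_eq_0_iff neg_equal_0_iff_equal power_eq_0_iff norm_eq_zero) simp
    moreover have "n * cnj u / cnj n \<noteq> 0" using n assms by simp
    ultimately show ?thesis
      using line_dir_dir[of "n * cnj u / cnj n" v x] assms(2) unfolding img[OF n] by blast
  qed
  have "angle_bisectors x (line_dir x u) (line_dir x v) =
      {m. (\<exists>n. n \<noteq> 0 \<and> m = line_dir x n) \<and> line_reflection m ` line_dir x u = line_dir x v}"
    unfolding angle_bisectors_def affine_line_iff[symmetric] by simp
  also have "\<dots> = {line_dir x n | n. n \<noteq> 0 \<and> Im (u * v * cnj (n\<^sup>2)) = 0}"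
    using bis by (intro Collect_cong iffI; elim conjE exE) (metis+)
  finally show ?thesis .
qed

lemma isogonal_line_dir:
  assumes "u \<noteq> 0" "u' \<noteq> 0" "v \<noteq> 0" "v' \<noteq> 0"
  shows "isogonal x (line_dir x u) (line_dir x u') (line_dir x v) (line_dir x v') \<longleftrightarrow>
           Im (u * u' * cnj (v * v')) = 0"
proof
  assume iso: "isogonal x (line_dir x u) (line_dir x u') (line_dir x v) (line_dir x v')"
  define n where "n = csqrt (u * u')"
  have n: "n\<^sup>2 = u * u'" "n \<noteq> 0" using assms by (auto simp: n_def)
  have "Im (u * u' * cnj (n\<^sup>2)) = 0" unfolding n by (simp add: algebra_simps)
  then have "line_dir x n \<in> angle_bisectors x (line_dir x v) (line_dir x v')"
    using iso n(2) unfolding isogonal_def angle_bisectors_line_dir[OF assms(1,2)] by blast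
  then obtain n' where n': "line_dir x n = line_dir x n'" "n' \<noteq> 0" "Im (v * v' * cnj (n'\<^sup>2)) = 0"
    unfolding angle_bisectors_line_dir[OF assms(3,4)] by blast
  then have "n \<in> line_dir 0 n'" using n line_dir_dir[of n n' x] by (simp add: line_dir_eq)
  then obtain k :: real where k: "n = of_real k * n'" by (auto simp: line_dir_def)
  have "u * u' * cnj (v * v') = of_real (k\<^sup>2) * cnj (v * v' * cnj (n'\<^sup>2))"
    unfolding n(1)[symmetric] k by (simp add: power_mult_distrib algebra_simps)
  then show "Im (u * u' * cnj (v * v')) = 0"
    using n'(3) by (simp only: Im_complex_of_real times_complex.sel(2) cnj.sel)
next
  assume "Im (u * u' * cnj (v * v')) = 0"
  then have "u * u' \<in> line_dir 0 (v * v')" using assms by (simp add: line_dir_eq)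
  then obtain k :: real where k: "u * u' = of_real k * (v * v')" by (auto simp: line_dir_def)
  then have "k \<noteq> 0" using assms by auto
  then have "Im (u * u' * cnj (n\<^sup>2)) = 0 \<longleftrightarrow> Im (v * v' * cnj (n\<^sup>2)) = 0" for n
    unfolding k mult.assoc by (simp only: times_complex.sel Re_complex_of_real Im_complex_of_real) simp
  then show "isogonal x (line_dir x u) (line_dir x u') (line_dir x v) (line_dir x v')"
    using assms by (simp add: isogonal_def angle_bisectors_line_dir)
qed

lemma affine_part_line_through:
  "affine_part (line_through (fin_pt x) (span {v})) = line_dir x (fst v - of_real (snd v) * x)"
proof -
  have "z \<in> affine_part (line_through (fin_pt x) (span {v})) \<longleftrightarrow>
          (\<exists>k l. z = of_real k * x + of_real l * fst v \<and> 1 = k + l * snd v)" for z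
  proof -
    have "z \<in> affine_part (line_through (fin_pt x) (span {v})) \<longleftrightarrow>
            (\<exists>k l. (z, 1) = k *\<^sub>R (x, 1) + l *\<^sub>R v)"
      unfolding affine_part_def line_through_def fin_pt_def span_Un span_span
      by (fastforce simp: span_singleton simp del: scaleR_Pair add_Pair)
    then show ?thesis by (cases v) (simp add: scaleR_conv_of_real)
  qed
  moreover have "(\<exists>k l. z = of_real k * x + of_real l * fst v \<and> 1 = k + l * snd v) \<longleftrightarrow>
      z \<in> line_dir x (fst v - of_real (snd v) * x)" for z
  proof
    assume "\<exists>k l. z = of_real k * x + of_real l * fst v \<and> 1 = k + l * snd v"
    then obtain k l where z: "z = of_real k * x + of_real l * fst v" "1 = k + l * snd v" by blast
    then have "k = 1 - l * snd v" by simp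
    then have "z = x + of_real l * (fst v - of_real (snd v) * x)" using z(1) by (simp add: ring_distribs)
    then show "z \<in> line_dir x (fst v - of_real (snd v) * x)" unfolding line_dir_def by blast
  next
    assume "z \<in> line_dir x (fst v - of_real (snd v) * x)"
    then obtain l :: real where "z = x + of_real l * (fst v - of_real (snd v) * x)"
      by (auto simp: line_dir_def)
    then have "z = of_real (1 - l * snd v) * x + of_real l * fst v" by (simp add: algebra_simps)
    then show "\<exists>k l. z = of_real k * x + of_real l * fst v \<and> 1 = k + l * snd v"
      by (intro exI[of _ "1 - l * snd v"] exI[of _ l]) simp
  qed
  ultimately show ?thesis by blast
qed

theorem isogonal_cubic_locus_finite:
  assumes "x \<notin> {a, b, c, d}"
  defines "L \<equiv> \<lambda>y. affine_part (line_through (fin_pt x) (fin_pt y))"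
  shows "fin_pt x \<in> isogonal_cubic a b c d \<longleftrightarrow> isogonal x (L a) (L c) (L b) (L d)"
proof -
  have L: "L y = line_dir x (y - x)" for y
    using affine_part_line_through[of x "(y, 1)"] by (simp add: L_def fin_pt_def)
  have "isogonal x (L a) (L c) (L b) (L d) \<longleftrightarrow>
          Im ((a - x) * (c - x) * cnj ((b - x) * (d - x))) = 0"
    unfolding L using assms(1) by (intro isogonal_line_dir) auto
  moreover have "fin_pt x \<in> isogonal_cubic a b c d \<longleftrightarrow>
      (let q = (x - a) * (x - c) * cnj ((x - b) * (x - d)) in cnj q = q)"
    unfolding isogonal_cubic_finite Let_def by (simp add: mult_ac)
  moreover have "(x - a) * (x - c) * cnj ((x - b) * (x - d)) =
      (a - x) * (c - x) * cnj ((b - x) * (d - x))"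
    by (simp add: algebra_simps)
  moreover have "cnj q = q \<longleftrightarrow> Im q = 0" for q by (auto simp: complex_eq_iff)
  ultimately show ?thesis by (simp only: Let_def)
qed

theorem isogonal_cubic_locus_infinite:
  assumes "v \<noteq> 0"
  defines "P \<equiv> span {(v, 0)}"
  defines "L \<equiv> \<lambda>y. affine_part (line_through (fin_pt y) P)"
  shows "P \<in> isogonal_cubic a b c d \<longleftrightarrow> isogonal_at_infinity (L a) (L c) (L b) (L d)"
proof -
  have L: "L y = line_dir y v" for y
    using affine_part_line_through[of y "(v, 0)"] by (simp add: L_def P_def)
  define s where "s = b + d - a - c"
  have "isogonal_form a b c d (v, 0) = Im ((b + d) * v * - cnj (v\<^sup>2) - v\<^sup>2 * cnj ((a + c) * v))"
    by (simp add: isogonal_form_def Let_def power2_eq_square algebra_simps)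
  also have "\<dots> = - (cmod v)\<^sup>2 * Im (s * cnj v)"
    unfolding cmod_power2 s_def by (simp add: power2_eq_square algebra_simps)
  finally have P: "P \<in> isogonal_cubic a b c d \<longleftrightarrow> Im (s * cnj v) = 0"
    unfolding P_def using assms(1) by (simp add: span_in_isogonal_cubic zero_prod_def)
  have "isogonal_at_infinity (L a) (L c) (L b) (L d) \<longleftrightarrow> Im (s * cnj v) = 0"
  proof
    assume iso: "isogonal_at_infinity (L a) (L c) (L b) (L d)"
    define n where "n = line_dir 0 (\<i> * v)"
    define p where "p y = \<i> * v * of_real (Im (y * cnj v) / (cmod v)\<^sup>2)" for y
    have n: "affine n \<and> aff_dim n = 1 \<and> 0 \<in> n"
      using affine_line_iff[of n 0] assms(1) by (auto simp: n_def intro!: exI[of _ "\<i> * v"])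
    have vv: "(cmod v)\<^sup>2 = Re v * Re v + Im v * Im v" "(cmod v)\<^sup>2 \<noteq> 0"
      using assms(1) unfolding cmod_power2 by (simp_all add: power2_eq_square complex_eq_iff)
    have int: "n \<inter> L y = {p y}" for y
    proof -
      have "z \<in> n \<inter> L y \<longleftrightarrow> z = p y" for z
      proof
        assume "z \<in> n \<inter> L y"
        then have "z \<in> n" and im: "Im ((z - y) * cnj v) = 0"
          using assms(1) by (simp_all add: L line_dir_eq)
        then obtain k :: real where z: "z = of_real k * (\<i> * v)"
          by (auto simp: n_def line_dir_def)
        from im have "k * (cmod v)\<^sup>2 = Im (y * cnj v)"
          unfolding vv(1) z by (simp add: algebra_simps)
        then have "k = Im (y * cnj v) / (cmod v)\<^sup>2" using vv(2) by (simp add: field_simps)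
        then show "z = p y" by (simp add: z p_def)
      next
        assume z: "z = p y"
        define k where "k = Im (y * cnj v) / (cmod v)\<^sup>2"
        have k: "k * (cmod v)\<^sup>2 = Im (y * cnj v)" using vv(2) by (simp add: k_def)
        have z: "z = 0 + of_real k * (\<i> * v)" by (simp add: z p_def k_def)
        have "z \<in> n" unfolding n_def line_dir_def using z by blast
        moreover have "Im ((z - y) * cnj v) = 0"
          using k unfolding vv(1) z by (simp add: algebra_simps)
        ultimately show "z \<in> n \<inter> L y" using assms(1) by (simp add: L line_dir_eq)
      qed
      then show ?thesis by blast
    qed
    have "p b - p a = p c - p d"
      using iso n int unfolding isogonal_at_infinity_def by blast
    then have "of_real (Im (b * cnj v) / (cmod v)\<^sup>2) - of_real (Im (a * cnj v) / (cmod v)\<^sup>2) =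
        (of_real (Im (c * cnj v) / (cmod v)\<^sup>2) - of_real (Im (d * cnj v) / (cmod v)\<^sup>2) :: complex)"
      using assms(1) unfolding p_def right_diff_distrib[symmetric] by simp
    then have "Im (b * cnj v) / (cmod v)\<^sup>2 - Im (a * cnj v) / (cmod v)\<^sup>2 =
        Im (c * cnj v) / (cmod v)\<^sup>2 - Im (d * cnj v) / (cmod v)\<^sup>2"
      by (metis of_real_diff of_real_eq_iff)
    then have "Im (b * cnj v) - Im (a * cnj v) = Im (c * cnj v) - Im (d * cnj v)"
      using vv(2) by (simp add: diff_divide_distrib[symmetric])
    then show "Im (s * cnj v) = 0" by (simp add: s_def algebra_simps)
  next
    assume s: "Im (s * cnj v) = 0"
    show "isogonal_at_infinity (L a) (L c) (L b) (L d)"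
      unfolding isogonal_at_infinity_def
    proof (intro allI impI, elim conjE)
      fix n e f g h
      assume n: "affine n" "aff_dim n = 1" and
        int: "n \<inter> L a = {e}" "n \<inter> L b = {f}" "n \<inter> L c = {g}" "n \<inter> L d = {h}"
      obtain u where u: "u \<noteq> 0" "n = line_dir e u" using affine_line_iff[of n e] n int(1) by blast
      have ea: "Im ((e - a) * cnj v) = 0" "Im ((f - b) * cnj v) = 0"
               "Im ((g - c) * cnj v) = 0" "Im ((h - d) * cnj v) = 0"
        using int assms(1) line_dir_eq[of v] unfolding L by blast+
      have uv: "Im (u * cnj v) \<noteq> 0"
      proof
        assume "Im (u * cnj v) = 0"
        then have "Im ((e + u - a) * cnj v) = 0" using ea(1) by (simp add: algebra_simps)
        then have "e + u \<in> n \<inter> L a" using u assms(1) by (simp add: L line_dir_eq)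
        then have "e + u = e" using int(1) by blast
        then show False using u(1) by simp
      qed
      have "f \<in> n" "g \<in> n" "h \<in> n" using int by blast+
      then obtain k l m :: real where
        klm: "f = e + of_real k * u" "g = e + of_real l * u" "h = e + of_real m * u"
        unfolding u line_dir_def by blast
      have "Im ((f - e - (g - h)) * cnj v) = 0"
        using ea s by (simp add: s_def algebra_simps)
      moreover have "(f - e - (g - h)) * cnj v = of_real (k - l + m) * (u * cnj v)"
        by (simp add: klm algebra_simps)
      ultimately have "(k - l + m) * Im (u * cnj v) = 0"
        by (simp only: times_complex.sel Re_complex_of_real Im_complex_of_real)
      then have "k = l - m" using uv by simp
      then show "f - e = g - h" by (simp add: klm ring_distribs)
    qed
  qed
  then show ?thesis using P by simp
qed


section \<open>The tangents at the vertices\<close>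

lemma frechet_derivative_isogonal_form:
  "frechet_derivative (isogonal_form a b c d) (at (a, 1)) =
     (\<lambda>(w, t). Im ((a - b) * (a - d) * cnj ((w - of_real t * a) * (a - c))))"
proof (rule frechet_derivative_at[symmetric])
  have "isogonal_form a b c d = (\<lambda>p.
     let r = (b + d) * fst p - b * d * of_real (snd p);
         s = (a + c) * fst p - a * c * of_real (snd p)
     in Im (of_real (snd p) * r * cnj s - r * cnj (fst p ^ 2) - fst p ^ 2 * cnj s))"
    by (simp add: isogonal_form_def case_prod_unfold)
  then show "(isogonal_form a b c d has_derivative
     (\<lambda>(w, t). Im ((a - b) * (a - d) * cnj ((w - of_real t * a) * (a - c))))) (at (a, 1))"
    unfolding Let_def
    apply (simp only:)
    apply (rule derivative_eq_intros bounded_linear.has_derivative[OF bounded_linear_Im]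
      bounded_linear.has_derivative[OF bounded_linear_cnj]
      bounded_linear.has_derivative[OF bounded_linear_of_real] refl)+
    apply (rule ext)
    apply (simp add: case_prod_unfold power2_eq_square algebra_simps)
    done
qed

lemma isogonal_form_swap: "isogonal_form c b a d = isogonal_form a b c d"
  by (simp add: isogonal_form_def add.commute mult.commute)

lemma fin_pt_inj: "fin_pt x = fin_pt y \<longleftrightarrow> x = y"
proof
  assume "fin_pt x = fin_pt y"
  moreover have "(x, 1) \<in> fin_pt x" unfolding fin_pt_def by (intro span_base) simp
  ultimately have "(x, 1) \<in> span {(y, 1::real)}" by (simp add: fin_pt_def)
  then show "x = y" by (auto simp: span_singleton)
qed simp

lemma vertex_line_other: "u \<noteq> y \<Longrightarrow> vertex_line a b c d u (fin_pt y) = line_dir u (y - u)"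
  using affine_part_line_through[of u "(y, 1)"]
  by (simp add: vertex_line_def fin_pt_inj fin_pt_def[symmetric])

lemma vertex_line_tangent:
  assumes "quadrilateral a b c d"
  shows "vertex_line a b c d a (fin_pt a) = line_dir a ((a - b) * (a - d) * cnj (a - c))"
proof -
  define k where "k = (a - b) * (a - d) * cnj (a - c)"
  have "k \<noteq> 0" using assms by (simp add: k_def quadrilateral_def)
  moreover have "(a - b) * (a - d) * cnj ((z - a) * (a - c)) = cnj ((z - a) * cnj k)" for z
    by (simp add: k_def mult_ac)
  ultimately show ?thesis unfolding k_def[symmetric]
    by (auto simp: vertex_line_def tangent_line_def affine_part_def frechet_derivative_isogonal_form
        line_dir_eq simp del: complex_cnj_mult times_complex.sel)
qed

theorem opposite_vertices_isogonal_conjugates: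
  assumes q: "quadrilateral a b c d"
  shows "isogonal_conjugates a b c d (fin_pt a) (fin_pt c)"
proof -
  have ne: "a \<noteq> b" "b \<noteq> a" "a \<noteq> c" "c \<noteq> a" "a \<noteq> d" "d \<noteq> a"
    "b \<noteq> c" "c \<noteq> b" "b \<noteq> d" "d \<noteq> b" "c \<noteq> d" "d \<noteq> c"
    using q by (auto simp: quadrilateral_def)
  have rp: "fin_pt y \<in> RP2" for y
    by (simp add: RP2_def fin_pt_def dim_span_singleton zero_prod_def)
  have tan: "isogonal a (vertex_line a b c d a (fin_pt a)) (line_dir a (c - a))
      (line_dir a (b - a)) (line_dir a (d - a))" if q: "quadrilateral a b c d" for a b c d
  proof -
    have "Im ((a - b) * (a - d) * cnj (a - c) * (c - a) * cnj ((b - a) * (d - a))) = 0"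
    proof -
      have "(a - b) * (a - d) * cnj (a - c) * (c - a) * cnj ((b - a) * (d - a)) =
          - (((a - b) * (a - d) * (a - c)) * cnj ((a - b) * (a - d) * (a - c)))"
        by (simp add: algebra_simps)
      also have "Im \<dots> = 0" by (simp only: complex_mult_cnj uminus_complex.sel Im_complex_of_real)
      finally show ?thesis .
    qed
    then show ?thesis unfolding vertex_line_tangent[OF q] using q
      by (subst isogonal_line_dir) (auto simp: quadrilateral_def)
  qed
  have "quadrilateral c b a d" using q by (auto simp: quadrilateral_def)
  from tan[OF this] have c: "isogonal c (vertex_line a b c d c (fin_pt c)) (line_dir c (a - c))
      (line_dir c (b - c)) (line_dir c (d - c))"
    by (simp add: vertex_line_def isogonal_form_swap)
  have isosym: "isogonal x l l' m m' \<Longrightarrow> isogonal x l' l m m'"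
    if "l' = line_dir x u'" "l = line_dir x u" "u \<noteq> 0" "u' \<noteq> 0" for x l l' m m' u u'
    using that unfolding isogonal_def by (simp add: angle_bisectors_line_dir mult.commute)
  have "vertex_line a b c d c (fin_pt c) = line_dir c ((c - b) * (c - d) * cnj (c - a))"
    using vertex_line_tangent[OF \<open>quadrilateral c b a d\<close>]
    by (simp add: vertex_line_def isogonal_form_swap)
  then have "isogonal c (line_dir c (a - c)) (vertex_line a b c d c (fin_pt c))
      (line_dir c (b - c)) (line_dir c (d - c))"
    using ne by (intro isosym[OF refl _ _ _ c]) auto
  moreover have "isogonal d (line_dir d (a - d)) (line_dir d (c - d)) (line_dir d (c - d)) (line_dir d (a - d))"
    using ne unfolding isogonal_def by (simp add: angle_bisectors_line_dir mult.commute)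
  ultimately show ?thesis
    unfolding isogonal_conjugates_def Let_def using tan[OF q] ne rp
    by (simp add: vertex_line_other) (simp add: isogonal_def)
qed

end

theory Submission
  imports Defs "HOL-Real_Asymp.Real_Asymp"
begin

text \<open>
  Put \<open>R(z) = (z - b)(z - d) / ((z - a)(z - c))\<close>. The finite points of the isogonal cubic are those
  with \<open>R(z)\<close> real, and isogonal conjugation is the deck involution of the double cover \<open>R\<close>, i.e. the
  Moebius involution \<open>(x - f)(x' - f) = m\<close> that exchanges \<open>a, c\<close> as well as \<open>b, d\<close>; it exchanges the
  focus \<open>f\<close> with the real point at infinity. In the coordinate \<open>\<zeta> = (z - f) / s\<close>, where
  \<open>s = a + c - b - d\<close>, the cubic is \<open>\<bar>\<zeta>\<bar>\<^sup>2 (Im \<zeta> - k) + Im (n cnj \<zeta>) = 0\<close> with \<open>n = m / s\<^sup>2\<close>.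

  Two such equations of the same point set agree in their cubic terms, so their difference is a conic
  that meets the cubic in infinitely many points. Both are quadratic in \<open>Re \<zeta>\<close>, and their resultant
  can vanish identically only if the conic is zero or the cubic contains a line; the latter is
  excluded by irreducibility. Hence \<open>f\<close> and \<open>m\<close> depend on the cubic only.
\<close>

section \<open>Lines in the projective plane\<close>

lemma span_scaleR_singleton: "k \<noteq> 0 \<Longrightarrow> span {k *\<^sub>R v} = span {v}"
  for v :: "'a :: real_vector"
proof (rule span_eq[THEN iffD2], intro conjI)
  assume "k \<noteq> 0"
  then have "v = (1 / k) *\<^sub>R k *\<^sub>R v" by simp
  then have "v \<in> span {k *\<^sub>R v}" by (metis insertI1 span_base span_scale)
  then show "{v} \<subseteq> span {k *\<^sub>R v}" by simp
qed (simp add: span_base span_scale)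

lemma mem_RP2_iff: "X \<in> RP2 \<longleftrightarrow> (\<exists>v. v \<noteq> 0 \<and> X = span {v})"
proof
  assume "X \<in> RP2"
  then have X: "subspace X" "dim X = 1" by (auto simp: RP2_def)
  obtain B where B: "B \<subseteq> X" "independent B" "X \<subseteq> span B" "card B = dim X"
    using basis_exists[of X] by blast
  then obtain v where v: "B = {v}" using X(2) by (auto simp: card_1_singleton_iff)
  then have "X = span {v}" using B X(1) by (metis span_eq_iff span_mono subset_antisym)
  moreover have "v \<noteq> 0" using B(2) v dependent_zero by blast
  ultimately show "\<exists>v. v \<noteq> 0 \<and> X = span {v}" by blast
qed (auto simp: RP2_def dim_span_singleton simp del: dim_span)

lemma fin_pt_in_RP2: "fin_pt z \<in> RP2"
  unfolding mem_RP2_iff fin_pt_def by (intro exI[of _ "(z, 1)"]) (simp add: zero_prod_def)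

lemma span_eq_fin_pt_iff:
  assumes "v \<noteq> 0"
  shows "span {v} = fin_pt a \<longleftrightarrow> fst v = of_real (snd v) * a"
proof
  assume "span {v} = fin_pt a"
  then have "v \<in> span {(a, 1)}" by (metis fin_pt_def insertI1 span_base)
  then show "fst v = of_real (snd v) * a" by (auto simp: span_singleton scaleR_conv_of_real)
next
  assume "fst v = of_real (snd v) * a"
  then have v: "v = snd v *\<^sub>R (a, 1)" by (simp add: prod_eq_iff scaleR_conv_of_real)
  then have "snd v \<noteq> 0" using assms by (metis scaleR_zero_left)
  then show "span {v} = fin_pt a" using v by (metis span_scaleR_singleton fin_pt_def)
qed

definition projective_line :: "(complex \<times> real) set \<Rightarrow> bool" where
  "projective_line L \<longleftrightarrow> subspace L \<and> dim L = 2"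

lemma projective_line_kernel:
  fixes \<phi> :: "complex \<times> real \<Rightarrow> real"
  assumes "linear \<phi>" "\<phi> u \<noteq> 0"
  shows "projective_line {v. \<phi> v = 0}"
proof -
  define n where "n = adjoint \<phi> 1"
  have \<phi>: "\<phi> v = n \<bullet> v" for v
    using adjoint_works[OF assms(1), of v 1] by (simp add: n_def inner_commute)
  then have "n \<noteq> 0" using assms(2) by (metis inner_zero_left)
  then show ?thesis
    by (simp add: \<phi> projective_line_def subspace_hyperplane dim_hyperplane)
qed

lemma line_through_eq:
  assumes L: "projective_line L" and RP2: "P \<in> RP2" "Q \<in> RP2" and "P \<noteq> Q"
    and on_L: "P \<subseteq> L" "Q \<subseteq> L"
  shows "line_through P Q = L"
proof -
  obtain p q where pq: "p \<noteq> 0" "q \<noteq> 0" "P = span {p}" "Q = span {q}"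
    using RP2 by (auto simp: mem_RP2_iff)
  have "p \<notin> span {q}"
  proof
    assume "p \<in> span {q}"
    then obtain k where "p = k *\<^sub>R q" by (auto simp: span_singleton)
    then show False using pq \<open>P \<noteq> Q\<close> by (metis scaleR_zero_left span_scaleR_singleton)
  qed
  then have "dim (span {p, q}) = 2" using pq(2) by (simp add: dim_insert)
  moreover have "line_through P Q = span {p, q}"
    unfolding line_through_def pq insert_is_Un[of p "{q}"] span_Un span_span ..
  moreover have "line_through P Q \<subseteq> L"
    unfolding line_through_def using L on_L by (simp add: projective_line_def span_minimal)
  ultimately show ?thesis
    using L by (intro subspace_dim_equal) (auto simp: projective_line_def)
qed

definition contains_line :: "(complex \<times> real) set set \<Rightarrow> bool" where
  "contains_line K \<longleftrightarrow> (\<exists>L. projective_line L \<and> {P \<in> RP2. P \<subseteq> L} \<subseteq> K)"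

lemma contains_lineI:
  fixes \<phi> :: "complex \<times> real \<Rightarrow> real"
  assumes "linear \<phi>" "\<phi> u \<noteq> 0" and "\<And>v. v \<noteq> 0 \<Longrightarrow> \<phi> v = 0 \<Longrightarrow> span {v} \<in> K"
  shows "contains_line K"
  unfolding contains_line_def
proof (intro exI conjI)
  show "projective_line {v. \<phi> v = 0}" by (rule projective_line_kernel[OF assms(1,2)])
  show "{P \<in> RP2. P \<subseteq> {v. \<phi> v = 0}} \<subseteq> K"
    using assms(3) by (auto simp: mem_RP2_iff intro: span_base)
qed

section \<open>Irreducible forms\<close>

lemma poly_poly_at_polynomial:
  fixes g :: "'a::comm_semiring_1 poly poly"
  shows "poly (poly g l) z = poly (poly g [:poly l z:]) z"
  by (induction g) simp_all

lemma poly_poly_poly_at_polynomial: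
  fixes F :: "'a::comm_semiring_1 poly poly poly"
  shows "poly (poly (poly F l) [:y:]) z = poly (poly (poly F [:[:poly (poly l [:y:]) z:]:]) [:y:]) z"
  by (induction F) simp_all

lemma poly_map_poly_eval_const:
  "poly (map_poly (\<lambda>g. poly g l) F) [:x:] = poly (poly F [:[:x:]:]) l"
  for F :: "'a::comm_semiring_1 poly poly poly"
  by (induction F) (simp_all add: map_poly_pCons)

lemma poly_poly_map_poly_map_poly_eval_const:
  "poly (poly (map_poly (map_poly (\<lambda>g. poly g z)) F) [:x:]) y =
     poly (poly (poly F [:[:x:]:]) [:y:]) z"
  for F :: "'a::comm_semiring_1 poly poly poly"
proof -
  have "poly (map_poly (\<lambda>g. poly g z) g) y = poly (poly g [:y:]) z" for g :: "'a poly poly"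
    by (induction g) (simp_all add: map_poly_pCons)
  then show ?thesis by (induction F) (simp_all add: map_poly_pCons)
qed

lemma poly_poly_eq_0:
  fixes h :: "'a::{idom, ring_char_0} poly poly"
  assumes "\<And>y z. poly (poly h [:y:]) z = 0"
  shows "h = 0"
proof (rule ccontr)
  assume "h \<noteq> 0"
  then have "finite {p. poly h p = 0}" by (rule poly_roots_finite)
  moreover have "range (\<lambda>y. [:y:]) \<subseteq> {p. poly h p = 0}"
    using assms by (auto simp: poly_eq_poly_eq_iff[symmetric])
  moreover have "infinite (range (\<lambda>y::'a. [:y:]))"
    by (subst finite_image_iff) (auto simp: inj_on_def infinite_UNIV_char_0)
  ultimately show False using finite_subset by blast
qed

lemma X_minus_poly_dvdI:
  fixes F :: "'a::{idom, ring_char_0} poly poly poly"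
  assumes "\<And>y z. poly (poly (poly F [:[:poly (poly l [:y:]) z:]:]) [:y:]) z = 0"
  shows "[:- l, 1:] dvd F"
proof -
  have "poly F l = 0"
    by (rule poly_poly_eq_0, subst poly_poly_poly_at_polynomial, rule assms)
  then show ?thesis by (simp add: poly_eq_0_iff_dvd)
qed

lemma Y_minus_poly_dvdI:
  fixes F :: "'a::{idom, ring_char_0} poly poly poly"
  assumes "\<And>x z. poly (poly (poly F [:[:x:]:]) [:poly l z:]) z = 0"
  shows "[:[:- l, 1:]:] dvd F"
proof -
  have "map_poly (\<lambda>g. poly g l) F = 0"
    by (rule poly_poly_eq_0, unfold poly_map_poly_eval_const, subst poly_poly_at_polynomial,
        rule assms)
  then have "coeff (map_poly (\<lambda>g. poly g l) F) i = 0" for i by simp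
  then show ?thesis by (simp add: coeff_map_poly const_poly_dvd_iff poly_eq_0_iff_dvd)
qed

lemma Z_minus_const_dvdI:
  fixes F :: "'a::{idom, ring_char_0} poly poly poly"
  assumes "\<And>x y. poly (poly (poly F [:[:x:]:]) [:y:]) z = 0"
  shows "[:[:[:- z, 1:]:]:] dvd F"
proof -
  have "map_poly (map_poly (\<lambda>g. poly g z)) F = 0"
    by (rule poly_poly_eq_0, unfold poly_poly_map_poly_map_poly_eval_const, rule assms)
  then have "coeff (coeff (map_poly (map_poly (\<lambda>g. poly g z)) F) i) j = 0" for i j by simp
  then show ?thesis by (simp add: coeff_map_poly const_poly_dvd_iff poly_eq_0_iff_dvd)
qed

definition linear_form :: "real \<Rightarrow> real \<Rightarrow> real \<Rightarrow> real poly poly poly" where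
  "linear_form p q r = [:[:[:0, r:], [:q:]:], [:[:p:]:]:]"

lemma homogeneous_linear_form: "homogeneous 1 (linear_form p q r)"
  by (auto simp: homogeneous_def linear_form_def coeff_pCons split: nat.splits)

lemma linear_form_not_unit: "(p, q, r) \<noteq> (0, 0, 0) \<Longrightarrow> \<not> linear_form p q r dvd 1"
  by (auto simp: linear_form_def is_unit_poly_iff)

lemma linear_form_dvdI:
  assumes "(p, q, r) \<noteq> (0, 0, 0)"
    and "\<And>x y z. p * x + q * y + r * z = 0 \<Longrightarrow> eval3 F (Complex x y, z) = 0"
  shows "linear_form p q r dvd F"
proof -
  have vanish: "poly (poly (poly F [:[:x:]:]) [:y:]) z = 0" if "p * x + q * y + r * z = 0" for x y z
    using assms(2)[OF that] by (simp add: eval3_def)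
  have unit: "[:[:[:e:]:]:] * l dvd F \<longleftrightarrow> l dvd F" if "e \<noteq> 0" for e l
    using that by (intro mult_unit_dvd_iff') (simp add: is_unit_poly_iff dvd_field_iff)
  consider (X) "p \<noteq> 0" | (Y) "p = 0" "q \<noteq> 0" | (Z) "p = 0" "q = 0" "r \<noteq> 0"
    using assms(1) by auto
  then show ?thesis
  proof cases
    case X
    define l where "l = [:[:0, - r / p:], [:- q / p:]:]"
    have "[:- l, 1:] dvd F"
      by (intro X_minus_poly_dvdI vanish) (use X in \<open>simp add: l_def field_simps\<close>)
    moreover have "linear_form p q r = [:[:[:p:]:]:] * [:- l, 1:]"
      using X by (simp add: linear_form_def l_def)
    ultimately show ?thesis using unit[OF X] by metis
  next
    case Y
    define l where "l = [:0, - r / q:]"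
    have "[:[:- l, 1:]:] dvd F"
      by (intro Y_minus_poly_dvdI vanish) (use Y in \<open>simp add: l_def\<close>)
    moreover have "linear_form p q r = [:[:[:q:]:]:] * [:[:- l, 1:]:]"
      using Y by (simp add: linear_form_def l_def)
    ultimately show ?thesis using unit[OF Y(2)] by metis
  next
    case Z
    have "[:[:[:- 0, 1:]:]:] dvd F" by (intro Z_minus_const_dvdI vanish) (use Z in simp)
    moreover have "linear_form p q r = [:[:[:r:]:]:] * [:[:[:- 0, 1:]:]:]"
      using Z by (simp add: linear_form_def)
    ultimately show ?thesis using unit[OF Z(3)] by metis
  qed
qed

lemma homogeneous_dvd_irreducible:
  assumes F: "homogeneous m F" "irreducible F" and l: "homogeneous n l" "l dvd F" "\<not> l dvd 1"
  shows "m = n"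
proof -
  obtain Q where Q: "F = l * Q" using l(2) by blast
  then have "Q dvd 1" using F(2) l(3) by (auto dest: irreducibleD)
  then obtain e where e: "Q = [:[:[:e:]:]:]" "e \<noteq> 0"
    by (auto simp: is_unit_poly_iff dvd_field_iff)
  then have "F = smult [:[:e:]:] l" by (simp add: Q)
  then have coeff_F: "coeff (coeff (coeff F i) j) k = e * coeff (coeff (coeff l i) j) k" for i j k
    by simp
  have "l \<noteq> 0" using F(2) Q by auto
  then obtain i j k where ijk: "coeff (coeff (coeff l i) j) k \<noteq> 0"
    by (metis leading_coeff_0_iff)
  then have "i + j + k = n" using l(1) by (simp add: homogeneous_def)
  moreover have "i + j + k = m" using F(1) ijk e(2) coeff_F by (simp add: homogeneous_def)
  ultimately show ?thesis by simp
qed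

lemma irreducible_form_contains_no_line:
  assumes F: "homogeneous m F" "irreducible F" and "m \<noteq> 1"
  shows "\<not> contains_line (zero_locus (eval3 F))"
proof
  assume "contains_line (zero_locus (eval3 F))"
  then obtain L where L: "projective_line L" "{P \<in> RP2. P \<subseteq> L} \<subseteq> zero_locus (eval3 F)"
    by (auto simp: contains_line_def)
  have "dim L = DIM(complex \<times> real) - 1" using L(1) by (simp add: projective_line_def)
  then obtain n where n: "n \<noteq> 0" "L = {v. n \<bullet> v = 0}"
    using L(1) lowdim_eq_hyperplane by (metis projective_line_def span_eq_iff)
  define p q r where pqr_defs: "p = Re (fst n)" "q = Im (fst n)" "r = snd n"
  have pqr: "(p, q, r) \<noteq> (0, 0, 0)" using n(1) by (auto simp: pqr_defs prod_eq_iff complex_eq_iff)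
  have "eval3 F v = 0" if "v \<in> L" for v
  proof -
    obtain u where u: "u \<in> L" "u \<noteq> 0"
      using L(1) dim_eq_0[of L] by (auto simp: projective_line_def)
    define w where "w = (if v = 0 then u else v)"
    have w: "w \<in> L" "w \<noteq> 0" "v \<in> span {w}"
      using u that by (auto simp: w_def span_0 intro: span_base)
    then have "span {w} \<subseteq> L" using L(1) by (simp add: projective_line_def span_minimal)
    then have "span {w} \<in> zero_locus (eval3 F)" using L(2) w(2) mem_RP2_iff by blast
    then show ?thesis using w(3) by (simp add: zero_locus_def)
  qed
  then have "eval3 F (Complex x y, z) = 0" if "p * x + q * y + r * z = 0" for x y z
    using that by (simp add: n(2) pqr_defs inner_prod_def inner_complex_def)
  then have "linear_form p q r dvd F" using pqr by (intro linear_form_dvdI)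
  then show False
    using homogeneous_dvd_irreducible[OF F homogeneous_linear_form] linear_form_not_unit[OF pqr]
      \<open>m \<noteq> 1\<close> by simp
qed

section \<open>Circular cubics\<close>

lemma cubic_has_real_root:
  fixes a b c :: real
  shows "\<exists>x. x ^ 3 + a * x\<^sup>2 + b * x + c = 0"
proof -
  define g where "g x = x ^ 3 + a * x\<^sup>2 + b * x + c" for x
  have "filterlim g at_top at_top" "filterlim g at_bot at_bot"
    unfolding g_def by real_asymp+
  then have "eventually (\<lambda>x. g x > 0) at_top" "eventually (\<lambda>x. g x < 0) at_bot"
    by (auto simp: filterlim_at_top_dense filterlim_at_bot_dense)
  then obtain u v where sign: "\<And>x. x \<ge> u \<Longrightarrow> g x > 0" "\<And>x. x \<le> v \<Longrightarrow> g x < 0"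
    by (auto simp: eventually_at_top_linorder eventually_at_bot_linorder)
  have "\<exists>x\<ge>min u v. x \<le> max u v \<and> g x = 0"
    using sign(1)[of "max u v"] sign(2)[of "min u v"]
    by (intro IVT) (auto simp: g_def less_imp_le intro!: continuous_intros)
  then show ?thesis by (auto simp: g_def)
qed

lemma quadratics_common_root_imp_resultant_eq_0:
  fixes y :: "'a::comm_ring_1"
  assumes "a2 * y\<^sup>2 + a1 * y + a0 = 0" "b2 * y\<^sup>2 + b1 * y + b0 = 0"
  shows "(a2 * b0 - a0 * b2)\<^sup>2 - (a2 * b1 - a1 * b2) * (a1 * b0 - a0 * b1) = 0"
proof -
  let ?D = "a2 * b0 - a0 * b2" and ?E = "a2 * b1 - a1 * b2" and ?H = "a1 * b0 - a0 * b1"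
  have "?E * y + ?D = a2 * (b2 * y\<^sup>2 + b1 * y + b0) - b2 * (a2 * y\<^sup>2 + a1 * y + a0)"
    by (simp add: algebra_simps)
  then have "?E * y + ?D = 0" using assms by simp
  then have D: "?D = - (?E * y)" by (simp only: add_eq_0_iff)
  have "?E * y\<^sup>2 - ?H = b1 * (a2 * y\<^sup>2 + a1 * y + a0) - a1 * (b2 * y\<^sup>2 + b1 * y + b0)"
    by (simp add: algebra_simps)
  then have H: "?H = ?E * y\<^sup>2" using assms by simp
  show ?thesis unfolding D H by (simp add: power2_eq_square algebra_simps)
qed

definition circular_form :: "real \<Rightarrow> complex \<Rightarrow> complex \<times> real \<Rightarrow> real" where
  "circular_form k n = (\<lambda>(z, t). (cmod z)\<^sup>2 * (Im z - k * t) + t\<^sup>2 * Im (n * cnj z))"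

lemma circular_form_affine:
  "circular_form k n (z, 1) =
     (Im z - k) * (Re z)\<^sup>2 + Im n * Re z + ((Im z)\<^sup>2 * (Im z - k) - Re n * Im z)"
  by (simp add: circular_form_def cmod_power2 algebra_simps)

lemma degenerate_circular_form_vanishes_on_line:
  assumes "Im n = 0" "k * Re n = 0"
  obtains x where "\<And>z t. Im z = x * t \<Longrightarrow> circular_form k n (z, t) = 0"
proof (cases "Re n = 0")
  case True
  then show ?thesis using assms(1) by (intro that[of k]) (simp add: circular_form_def)
next
  case False
  then show ?thesis using assms by (intro that[of 0]) (simp add: circular_form_def)
qed

context
  fixes k :: real and n :: complex
  assumes nondegenerate: "Im n \<noteq> 0 \<or> k * Re n \<noteq> 0"
begin

lemma finite_circular_form_slice: "finite {z. circular_form k n (z, 1) = 0 \<and> Im z = x}"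
proof -
  define p where "p = [:x\<^sup>2 * (x - k) - Re n * x, Im n, x - k:]"
  have "p \<noteq> 0" using nondegenerate by (auto simp: p_def)
  then have "finite ((\<lambda>y. Complex y x) ` {y. poly p y = 0})" by (simp add: poly_roots_finite)
  moreover have "{z. circular_form k n (z, 1) = 0 \<and> Im z = x} \<subseteq>
      (\<lambda>y. Complex y x) ` {y. poly p y = 0}"
  proof clarify
    fix z
    assume "circular_form k n (z, 1) = 0" "x = Im z"
    then have "poly p (Re z) = 0"
      by (simp add: p_def circular_form_affine power2_eq_square algebra_simps)
    then show "z \<in> (\<lambda>y. Complex y (Im z)) ` {y. poly p y = 0}"
      by (intro image_eqI[of _ _ "Re z"]) simp_all
  qed
  ultimately show ?thesis by (rule rev_finite_subset)
qed

lemma infinite_Im_circular_form_zeros: "infinite (Im ` {z. circular_form k n (z, 1) = 0})"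
proof
  let ?Z = "{z. circular_form k n (z, 1) = 0}"
  assume "finite (Im ` ?Z)"
  then have "finite (\<Union>x\<in>Im ` ?Z. {z. circular_form k n (z, 1) = 0 \<and> Im z = x})"
    using finite_circular_form_slice by (rule finite_UN_I)
  then have "finite ?Z" by (rule rev_finite_subset) blast
  moreover have "Re ` ?Z = UNIV"
  proof (rule UNIV_eq_I[symmetric])
    fix y
    obtain x where "x ^ 3 + (- k) * x\<^sup>2 + (y\<^sup>2 - Re n) * x + (Im n * y - k * y\<^sup>2) = 0"
      using cubic_has_real_root by blast
    then have "circular_form k n (Complex y x, 1) = 0"
      by (simp add: circular_form_affine power3_eq_cube power2_eq_square algebra_simps)
    then show "y \<in> Re ` ?Z" by (intro image_eqI[of _ _ "Complex y x"]) simp_all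
  qed
  ultimately show False using infinite_UNIV_char_0[where 'a = real] by (metis finite_imageI)
qed

text \<open>
  The polynomial in \<open>x = Im z\<close> is the resultant of cubic and conic, read as quadratics in \<open>Re z\<close>;
  its coefficients of degree 6, 4 and 2 are in turn sums of two squares.
\<close>

lemma conic_eq_0_if_resultant_eq_0:
  assumes "infinite {x. ((x - k) * (q1 * x\<^sup>2 + q4 * x + q6) - (x\<^sup>2 * (x - k) - Re n * x) * q3)\<^sup>2
      - ((x - k) * (q2 * x + q5) - Im n * q3) *
        (Im n * (q1 * x\<^sup>2 + q4 * x + q6) - (x\<^sup>2 * (x - k) - Re n * x) * (q2 * x + q5)) = 0}"
  shows "q1 = 0 \<and> q2 = 0 \<and> q3 = 0 \<and> q4 = 0 \<and> q5 = 0 \<and> q6 = 0"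
proof -
  define \<alpha> \<beta> where "\<alpha> = Re n" "\<beta> = Im n"
  define D where "D = [:- k * q6, q6 - k * q4 + \<alpha> * q3, q4 - k * q1 + k * q3, q1 - q3:]"
  define E where "E = [:- k * q5 - \<beta> * q3, q5 - k * q2, q2:]"
  define H where
    "H = [:\<beta> * q6, \<beta> * q4 + \<alpha> * q5, \<beta> * q1 + k * q5 + \<alpha> * q2, k * q2 - q5, - q2:]"
  define R where "R = D\<^sup>2 - E * H"
  have "poly D x = (x - k) * (q1 * x\<^sup>2 + q4 * x + q6) - (x\<^sup>2 * (x - k) - \<alpha> * x) * q3"
    "poly E x = (x - k) * (q2 * x + q5) - \<beta> * q3"
    "poly H x = \<beta> * (q1 * x\<^sup>2 + q4 * x + q6) - (x\<^sup>2 * (x - k) - \<alpha> * x) * (q2 * x + q5)" for x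
    by (simp_all add: D_def E_def H_def power2_eq_square algebra_simps)
  then have "infinite {x. poly R x = 0}" using assms by (simp add: R_def \<alpha>_\<beta>_def)
  then have R: "R = 0" using poly_roots_finite by blast
  have "coeff R 6 = (q1 - q3)\<^sup>2 + q2\<^sup>2"
    by (simp add: R_def D_def E_def H_def power2_eq_square eval_nat_numeral)
  then have q123: "q3 = q1" "q2 = 0" using R by (simp_all add: sum_power2_eq_zero_iff)
  have "coeff R 4 = q4\<^sup>2 + q5\<^sup>2"
    by (simp add: R_def D_def E_def H_def q123 power2_eq_square eval_nat_numeral algebra_simps)
  then have q45: "q4 = 0" "q5 = 0" using R by (simp_all add: sum_power2_eq_zero_iff)
  have "coeff R 2 = (q6 + \<alpha> * q1)\<^sup>2 + (\<beta> * q1)\<^sup>2"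
    by (simp add: R_def D_def E_def H_def q123 q45 power2_eq_square eval_nat_numeral algebra_simps)
  then have q6: "q6 = - \<alpha> * q1" and "\<beta> * q1 = 0"
    using R by (simp_all add: sum_power2_eq_zero_iff)
  have "coeff R 0 = (k * q6)\<^sup>2 + \<beta> * q1 * (\<beta> * q6)"
    by (simp add: R_def D_def E_def H_def q123 q45 power2_eq_square algebra_simps)
  then have "k * \<alpha> * q1 = 0" using R q6 \<open>\<beta> * q1 = 0\<close> by simp
  then have "q1 = 0" using \<open>\<beta> * q1 = 0\<close> nondegenerate by (auto simp: \<alpha>_\<beta>_def)
  then show ?thesis using q123 q45 q6 by simp
qed

lemma conic_through_circular_form_zeros_eq_0:
  assumes conic: "\<And>z. circular_form k n (z, 1) = 0 \<Longrightarrow>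
      q1 * (Im z)\<^sup>2 + q2 * Im z * Re z + q3 * (Re z)\<^sup>2 + q4 * Im z + q5 * Re z + q6 = 0"
  shows "q1 = 0 \<and> q2 = 0 \<and> q3 = 0 \<and> q4 = 0 \<and> q5 = 0 \<and> q6 = 0"
proof (rule conic_eq_0_if_resultant_eq_0, rule infinite_super[OF _ infinite_Im_circular_form_zeros],
    rule image_subsetI, unfold mem_Collect_eq)
  fix z
  assume "circular_form k n (z, 1) = 0"
  then show "((Im z - k) * (q1 * (Im z)\<^sup>2 + q4 * Im z + q6)
        - ((Im z)\<^sup>2 * (Im z - k) - Re n * Im z) * q3)\<^sup>2
      - ((Im z - k) * (q2 * Im z + q5) - Im n * q3) *
        (Im n * (q1 * (Im z)\<^sup>2 + q4 * Im z + q6)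
          - ((Im z)\<^sup>2 * (Im z - k) - Re n * Im z) * (q2 * Im z + q5)) = 0"
    using conic[of z]
    by (intro quadratics_common_root_imp_resultant_eq_0[where y = "Re z"])
      (simp_all add: circular_form_affine algebra_simps)
qed

lemma circular_form_unique:
  assumes "\<And>z. circular_form k n (z, 1) = 0 \<Longrightarrow> circular_form k' n' (z - g, 1) = 0"
  shows "g = 0" "n' = n"
proof -
  let ?e = "Im g + k'"
  let ?q1 = "k - ?e - 2 * Im g" and ?q2 = "- 2 * Re g" and ?q3 = "k - ?e"
    and ?q4 = "(Im g)\<^sup>2 + (Re g)\<^sup>2 + 2 * Im g * ?e - Re n' + Re n"
    and ?q5 = "2 * Re g * ?e + Im n' - Im n"
    and ?q6 = "- ?e * ((Im g)\<^sup>2 + (Re g)\<^sup>2) - Im n' * Re g + Re n' * Im g"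
  have "?q1 * (Im z)\<^sup>2 + ?q2 * Im z * Re z + ?q3 * (Re z)\<^sup>2 + ?q4 * Im z + ?q5 * Re z + ?q6 =
      circular_form k' n' (z - g, 1) - circular_form k n (z, 1)" for z
    by (simp add: circular_form_affine power2_eq_square algebra_simps)
  then have conic_vanishes: "?q1 = 0 \<and> ?q2 = 0 \<and> ?q3 = 0 \<and> ?q4 = 0 \<and> ?q5 = 0 \<and> ?q6 = 0"
    using assms by (intro conic_through_circular_form_zeros_eq_0) simp
  then show "g = 0" by (simp add: complex_eq_iff)
  then show "n' = n" using conic_vanishes by (auto simp: complex_eq_iff)
qed

end

section \<open>The isogonal form\<close>

lemma of_real_cmod_power4: "complex_of_real ((cmod z) ^ 4) = (z * cnj z)\<^sup>2"
  by (simp add: complex_norm_square[symmetric] flip: power_mult)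

lemma Im_of_real_mult: "Im (of_real r * z) = r * Im z"
  by simp

lemma Im_mult_cnj_eq_0_iff:
  assumes "v \<noteq> 0"
  shows "Im (u * cnj v) = 0 \<longleftrightarrow> (\<exists>k::real. u = of_real k * v)"
  using line_dir_eq[OF assms, of u 0] by (auto simp: line_dir_def)

lemma isogonal_form_altdef:
  "isogonal_form a b c d (w, t) =
     Im (((a + c - b - d) * w - of_real t * (a * c - b * d)) *
       cnj ((w - of_real t * a) * (w - of_real t * c)))"
proof -
  define r s where "r = (b + d) * w - b * d * of_real t" "s = (a + c) * w - a * c * of_real t"
  have "(a + c - b - d) * w - of_real t * (a * c - b * d) = s - r"
    "(w - of_real t * a) * (w - of_real t * c) = w\<^sup>2 - of_real t * s"
    by (simp_all add: r_s_def power2_eq_square algebra_simps)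
  moreover have "Im (of_real t * r * cnj s - r * cnj (w\<^sup>2) - w\<^sup>2 * cnj s) =
      Im ((s - r) * cnj (w\<^sup>2 - of_real t * s))"
    by (simp add: power2_eq_square algebra_simps)
  ultimately show ?thesis unfolding isogonal_form_def Let_def by (simp add: r_s_def)
qed

lemma isogonal_form_rotate: "isogonal_form b c d a v = - isogonal_form a b c d v"
  by (cases v) (simp add: isogonal_form_def Let_def power2_eq_square algebra_simps)

lemma isogonal_form_at_infinity:
  "isogonal_form a b c d (w, 0) = (cmod w)\<^sup>2 * Im ((a + c - b - d) * cnj w)"
  unfolding cmod_power2 by (simp add: isogonal_form_altdef power2_eq_square algebra_simps)

lemma parallelogram_contains_line:
  assumes "a + c = b + d"
  shows "contains_line (isogonal_cubic a b c d)"
proof (rule contains_lineI[where \<phi> = snd and u = "(0, 1)"])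
  have "a + c - b - d = 0" using assms by (simp add: algebra_simps)
  then have "isogonal_form a b c d (w, 0) = 0" for w by (simp only: isogonal_form_at_infinity) simp
  then show "span {v} \<in> isogonal_cubic a b c d" if "v \<noteq> 0" "snd v = 0" for v
    using that by (cases v) (simp add: span_in_isogonal_cubic)
qed (simp_all add: bounded_linear.linear bounded_linear_snd)

lemma isogonal_form_collinear:
  "isogonal_form (p + of_real ka * e) (p + of_real kb * e) (p + of_real kc * e) (p + of_real kd * e)
     (of_real t * p + of_real l * e, t) = 0" (is "isogonal_form ?a ?b ?c ?d (?w, t) = 0")
proof -
  have "(?a + ?c - ?b - ?d) * ?w - of_real t * (?a * ?c - ?b * ?d) =
      of_real ((ka + kc - kb - kd) * l - t * (ka * kc - kb * kd)) * e\<^sup>2"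
    "(?w - of_real t * ?a) * (?w - of_real t * ?c) = of_real ((l - t * ka) * (l - t * kc)) * e\<^sup>2"
    by (simp_all add: power2_eq_square algebra_simps)
  then show ?thesis unfolding isogonal_form_altdef by (simp add: power2_eq_square algebra_simps)
qed

lemma contains_line_if_vertices_collinear:
  assumes L: "projective_line L" and "a \<noteq> b"
    and vertices: "\<And>u. u \<in> {a, b, c, d} \<Longrightarrow> (u, 1) \<in> L"
  shows "contains_line (isogonal_cubic a b c d)"
proof -
  have vertex_on_L: "fin_pt u \<subseteq> L" if "u \<in> {a, b, c, d}" for u
    using vertices[OF that] L by (simp add: fin_pt_def projective_line_def span_minimal)
  have join_vertices: "line_through (fin_pt a) (fin_pt b) = L"
    using L vertex_on_L \<open>a \<noteq> b\<close> by (intro line_through_eq) (auto simp: fin_pt_in_RP2 fin_pt_inj)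
  have parametrization: "\<exists>l. w = of_real t * a + of_real l * (b - a)" if w_t: "(w, t) \<in> L" for w t
  proof -
    have "(w, t) \<in> span ({(a, 1)} \<union> {(b, 1)})"
      using w_t unfolding join_vertices[symmetric] line_through_def fin_pt_def span_Un span_span .
    then obtain k l where "w = of_real k * a + of_real l * b" "t = k + l"
      unfolding span_Un span_singleton by (auto simp: scaleR_conv_of_real)
    then have "w = of_real t * a + of_real l * (b - a)" by (simp add: algebra_simps)
    then show ?thesis by blast
  qed
  obtain kc kd where cd: "c = a + of_real kc * (b - a)" "d = a + of_real kd * (b - a)"
    using parametrization[of c 1] parametrization[of d 1] vertices by auto
  have "isogonal_form a b c d v = 0" if v_on_L: "v \<in> L" for v
  proof -
    obtain w t where v: "v = (w, t)" by (cases v)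
    then obtain l where "w = of_real t * a + of_real l * (b - a)"
      using parametrization v_on_L by blast
    then show ?thesis
      using isogonal_form_collinear[of a 0 "b - a" 1 kc kd t l] by (simp add: v cd)
  qed
  then have "{P \<in> RP2. P \<subseteq> L} \<subseteq> isogonal_cubic a b c d"
    by (auto simp: isogonal_cubic_def zero_locus_def)
  then show ?thesis using L by (auto simp: contains_line_def)
qed

section \<open>Isogonality at the vertices\<close>

lemma isogonal_form_differentiable: "isogonal_form a b c d differentiable (at v)"
proof -
  have "isogonal_form a b c d = (\<lambda>p.
     let r = (b + d) * fst p - b * d * of_real (snd p);
         s = (a + c) * fst p - a * c * of_real (snd p)
     in Im (of_real (snd p) * r * cnj s - r * cnj (fst p ^ 2) - fst p ^ 2 * cnj s))"
    by (simp add: isogonal_form_def case_prod_unfold)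
  then show ?thesis
    unfolding Let_def differentiable_def
    by (auto intro!: derivative_eq_intros bounded_linear.has_derivative[OF bounded_linear_Im]
      bounded_linear.has_derivative[OF bounded_linear_cnj]
      bounded_linear.has_derivative[OF bounded_linear_of_real] exI)
qed

lemma vertex_line_rotate: "vertex_line b c d a = vertex_line a b c d"
proof -
  have "(isogonal_form b c d a has_derivative
      (\<lambda>x. - frechet_derivative (isogonal_form a b c d) (at v) x)) (at v)" for v
    unfolding isogonal_form_rotate[of b c d a, abs_def]
    by (intro has_derivative_minus frechet_derivative_works[THEN iffD1] isogonal_form_differentiable)
  then have "frechet_derivative (isogonal_form b c d a) (at v) =
      (\<lambda>x. - frechet_derivative (isogonal_form a b c d) (at v) x)" for v
    by (metis frechet_derivative_at)
  then show ?thesis by (intro ext) (simp add: vertex_line_def tangent_line_def)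
qed

text \<open>
  The direction of the line from the vertex \<open>a\<close> (with neighbours \<open>b\<close>, \<open>d\<close> and opposite vertex \<open>c\<close>)
  to the point \<open>span {v}\<close>; the first branch is the tangent at \<open>a\<close>.
\<close>

definition vertex_dir :: "complex \<Rightarrow> complex \<Rightarrow> complex \<Rightarrow> complex \<Rightarrow> complex \<times> real \<Rightarrow> complex" where
  "vertex_dir a b c d v =
     (if fst v = of_real (snd v) * a then (a - b) * (a - d) * cnj (a - c)
      else fst v - of_real (snd v) * a)"

lemma vertex_dir_nonzero: "quadrilateral a b c d \<Longrightarrow> vertex_dir a b c d v \<noteq> 0"
  by (auto simp: vertex_dir_def quadrilateral_def)

lemma vertex_line_eq_line_dir:
  assumes "quadrilateral a b c d" "v \<noteq> 0"
  shows "vertex_line a b c d a (span {v}) = line_dir a (vertex_dir a b c d v)"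
proof (cases "fst v = of_real (snd v) * a")
  case True
  then have "span {v} = fin_pt a" using span_eq_fin_pt_iff[OF assms(2)] by blast
  then show ?thesis using vertex_line_tangent[OF assms(1)] True by (simp add: vertex_dir_def)
next
  case False
  then show ?thesis using span_eq_fin_pt_iff[OF assms(2)]
    by (simp add: vertex_dir_def vertex_line_def affine_part_line_through)
qed

definition isogonal_at_vertex ::
    "complex \<Rightarrow> complex \<Rightarrow> complex \<Rightarrow> complex \<Rightarrow> complex \<times> real \<Rightarrow> complex \<times> real \<Rightarrow> bool" where
  "isogonal_at_vertex a b c d v v' \<longleftrightarrow>
     Im (vertex_dir a b c d v * vertex_dir a b c d v' * cnj ((b - a) * (d - a))) = 0"

lemma isogonal_at_vertex_sym: "isogonal_at_vertex a b c d v v' \<longleftrightarrow> isogonal_at_vertex a b c d v' v"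
  by (simp only: isogonal_at_vertex_def mult.commute[of "vertex_dir a b c d v"])

lemma isogonal_vertex_lines_iff:
  assumes q: "quadrilateral a b c d" and "v \<noteq> 0" "v' \<noteq> 0"
  defines "L \<equiv> vertex_line a b c d a"
  shows "isogonal a (L (span {v})) (L (span {v'})) (L (fin_pt b)) (L (fin_pt d))
           \<longleftrightarrow> isogonal_at_vertex a b c d v v'"
    and "isogonal a (L (span {v})) (L (span {v'})) (L (fin_pt d)) (L (fin_pt b))
           \<longleftrightarrow> isogonal_at_vertex a b c d v v'"
proof -
  have "a \<noteq> b" "a \<noteq> d" using q by (auto simp: quadrilateral_def)
  then have neighbours: "L (fin_pt b) = line_dir a (b - a)" "L (fin_pt d) = line_dir a (d - a)"
    by (simp_all add: L_def vertex_line_other)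
  have points: "L (span {v}) = line_dir a (vertex_dir a b c d v)"
    "L (span {v'}) = line_dir a (vertex_dir a b c d v')"
    unfolding L_def using assms by (simp_all add: vertex_line_eq_line_dir)
  have nonzero: "vertex_dir a b c d v \<noteq> 0" "vertex_dir a b c d v' \<noteq> 0" "b - a \<noteq> 0" "d - a \<noteq> 0"
    using vertex_dir_nonzero[OF q] \<open>a \<noteq> b\<close> \<open>a \<noteq> d\<close> by simp_all
  show "isogonal a (L (span {v})) (L (span {v'})) (L (fin_pt b)) (L (fin_pt d))
      \<longleftrightarrow> isogonal_at_vertex a b c d v v'"
    unfolding points neighbours isogonal_line_dir[OF nonzero] isogonal_at_vertex_def ..
  show "isogonal a (L (span {v})) (L (span {v'})) (L (fin_pt d)) (L (fin_pt b))
      \<longleftrightarrow> isogonal_at_vertex a b c d v v'"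
    unfolding points neighbours isogonal_line_dir[OF nonzero(1,2,4,3)] isogonal_at_vertex_def
      mult.commute[of "d - a" "b - a"] ..
qed

lemma isogonal_conjugates_iff:
  assumes q: "quadrilateral a b c d" and v: "v \<noteq> 0" "v' \<noteq> 0"
  shows "isogonal_conjugates a b c d (span {v}) (span {v'}) \<longleftrightarrow>
    isogonal_at_vertex a b c d v v' \<and> isogonal_at_vertex b c d a v v' \<and>
    isogonal_at_vertex c d a b v v' \<and> isogonal_at_vertex d a b c v v'"
proof -
  have rotated: "quadrilateral b c d a" "quadrilateral c d a b" "quadrilateral d a b c"
    using q by (auto simp: quadrilateral_def)
  have vertex_lines: "vertex_line b c d a = vertex_line a b c d"
    "vertex_line c d a b = vertex_line a b c d" "vertex_line d a b c = vertex_line a b c d"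
    by (metis vertex_line_rotate)+
  have "span {v} \<in> RP2" "span {v'} \<in> RP2" using v mem_RP2_iff by blast+
  moreover note isogonal_vertex_lines_iff(1)[OF q v] isogonal_vertex_lines_iff(2)[OF rotated(1) v]
    isogonal_vertex_lines_iff(2)[OF rotated(2) v] isogonal_vertex_lines_iff(2)[OF rotated(3) v]
  ultimately show ?thesis
    unfolding isogonal_conjugates_def Let_def by (simp only: vertex_lines simp_thms)
qed

lemma isogonal_at_vertex_on_line:
  assumes q: "quadrilateral a b c d"
  obtains L where "projective_line L" "(a, 1) \<in> L" "\<And>y. isogonal_at_vertex a b c d v y \<Longrightarrow> y \<in> L"
proof -
  define e where "e = vertex_dir a b c d v * cnj ((b - a) * (d - a))"
  define \<phi> where "\<phi> y = Im ((fst y - of_real (snd y) * a) * e)" for y :: "complex \<times> real"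
  have "e \<noteq> 0" using q vertex_dir_nonzero[OF q] by (auto simp: e_def quadrilateral_def)
  moreover have "\<phi> (\<i> * cnj e, 0) = (cmod e)\<^sup>2"
    unfolding cmod_power2 by (simp add: \<phi>_def power2_eq_square)
  ultimately have "\<phi> (\<i> * cnj e, 0) \<noteq> 0" by simp
  moreover have "linear \<phi>"
    by (rule linearI) (simp_all add: \<phi>_def algebra_simps)
  ultimately have "projective_line {y. \<phi> y = 0}" by (intro projective_line_kernel)
  moreover have "(a, 1) \<in> {y. \<phi> y = 0}" by (simp add: \<phi>_def)
  moreover have "y \<in> {y. \<phi> y = 0}" if "isogonal_at_vertex a b c d v y" for y
  proof (cases "fst y = of_real (snd y) * a")
    case False
    then have "vertex_dir a b c d v * vertex_dir a b c d y * cnj ((b - a) * (d - a)) =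
        (fst y - of_real (snd y) * a) * e"
      by (simp add: vertex_dir_def[of _ _ _ _ y] e_def mult_ac)
    then show ?thesis using that by (simp add: isogonal_at_vertex_def \<phi>_def)
  qed (simp add: \<phi>_def)
  ultimately show ?thesis using that by blast
qed

text \<open>
  The conjugates of a point lie on the reflected line through each vertex. The line joining two of
  them would be all four reflected lines and so carry all four vertices.
\<close>

lemma isogonal_conjugate_unique:
  assumes q: "quadrilateral a b c d"
    and no_line: "\<not> contains_line (isogonal_cubic a b c d)"
    and Y: "isogonal_conjugates a b c d X Y" "isogonal_conjugates a b c d X Y'"
  shows "Y = Y'"
proof (rule ccontr)
  assume "Y \<noteq> Y'"
  have RP2: "X \<in> RP2" "Y \<in> RP2" "Y' \<in> RP2" using Y by (auto simp: isogonal_conjugates_def)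
  then obtain v y y' where v: "v \<noteq> 0" "y \<noteq> 0" "y' \<noteq> 0"
    "X = span {v}" "Y = span {y}" "Y' = span {y'}"
    by (auto simp: mem_RP2_iff)
  let ?M = "line_through Y Y'"
  have vertex: "projective_line ?M \<and> (a, 1) \<in> ?M"
    if "quadrilateral a b c d"
      and at: "isogonal_at_vertex a b c d v y" "isogonal_at_vertex a b c d v y'"
    for a b c d
  proof -
    obtain L where L: "projective_line L" "(a, 1) \<in> L" "y \<in> L" "y' \<in> L"
      using isogonal_at_vertex_on_line[OF \<open>quadrilateral a b c d\<close>, of v] at by metis
    then have "Y \<subseteq> L" "Y' \<subseteq> L" by (simp_all add: v projective_line_def span_minimal)
    then have "?M = L" using L(1) RP2 \<open>Y \<noteq> Y'\<close> by (intro line_through_eq)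
    then show ?thesis using L by simp
  qed
  have "quadrilateral b c d a" "quadrilateral c d a b" "quadrilateral d a b c"
    using q by (auto simp: quadrilateral_def)
  then have "projective_line ?M \<and> (\<forall>u\<in>{a, b, c, d}. (u, 1) \<in> ?M)"
    using Y q vertex v by (auto simp: isogonal_conjugates_iff)
  then show False
    using no_line contains_line_if_vertices_collinear q
    by (metis quadrilateral_def distinct_length_2_or_more)
qed

section \<open>Conjugation as a Moebius involution\<close>

text \<open>
  The focus \<open>f\<close> is the point exchanged with the real point at infinity, which lies in direction \<open>s\<close>.
\<close>

definition focal_conjugate ::
    "complex \<Rightarrow> complex \<Rightarrow> complex \<Rightarrow> complex \<times> real \<Rightarrow> complex \<times> real" where
  "focal_conjugate f m s v =
     (if fst v = of_real (snd v) * f then (s, 0)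
      else (f + of_real (snd v) * m / (fst v - of_real (snd v) * f), 1))"

lemma focal_conjugate_nonzero: "s \<noteq> 0 \<Longrightarrow> focal_conjugate f m s v \<noteq> 0"
  by (simp add: focal_conjugate_def zero_prod_def)

locale focal_quadrilateral =
  fixes a b c d f m s :: complex
  assumes quad: "quadrilateral a b c d"
    and not_parallelogram: "a + c \<noteq> b + d"
    and ac: "(a - f) * (c - f) = m"
    and bd: "(b - f) * (d - f) = m"
    and axis_nonzero: "s \<noteq> 0"
    and axis: "Im ((a + c - b - d) * cnj s) = 0"
begin

lemma rotate: "focal_quadrilateral b c d a f m s"
  using quad not_parallelogram ac bd axis_nonzero axis
  by unfold_locales (auto simp: quadrilateral_def algebra_simps)

lemma m_nonzero: "m \<noteq> 0"
  using quad ac bd by (auto simp: quadrilateral_def)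

lemma vertex_ne_focus: "a \<noteq> f" "c \<noteq> f"
  using m_nonzero ac by auto

lemma adjacent_product: "(b - a) * (d - a) = (a - f) * (a + c - b - d)"
proof -
  have "(b - a) * (d - a) = (b - f) * (d - f) - (a - f) * (c - f) + (a - f) * (a + c - b - d)"
    by (simp add: algebra_simps)
  then show ?thesis by (simp add: ac bd)
qed

lemma axis_multiple:
  obtains \<rho> :: real where "\<rho> \<noteq> 0" "a + c - b - d = of_real \<rho> * s"
proof -
  obtain \<rho> :: real where \<rho>: "a + c - b - d = of_real \<rho> * s"
    using axis Im_mult_cnj_eq_0_iff[OF axis_nonzero] by blast
  moreover have "\<rho> \<noteq> 0" using not_parallelogram \<rho> by (auto simp: algebra_simps)
  ultimately show ?thesis using that by blast
qed

lemma isogonal_form_focal: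
  "isogonal_form a b c d (w, t) =
     Im ((a + c - b - d) * (w - of_real t * f) * cnj ((w - of_real t * a) * (w - of_real t * c)))"
proof -
  have "(a - f) * (c - f) = (b - f) * (d - f)" by (simp add: ac bd)
  then have "(a + c - b - d) * f = a * c - b * d" by algebra
  then have "(a + c - b - d) * w - of_real t * (a * c - b * d) =
      (a + c - b - d) * (w - of_real t * f)"
    by (metis mult.left_commute right_diff_distrib)
  then show ?thesis by (simp only: isogonal_form_altdef)
qed

lemma isogonal_form_eq_0_iff:
  "isogonal_form a b c d (w, t) = 0 \<longleftrightarrow>
     Im (s * (w - of_real t * f) * cnj ((w - of_real t * a) * (w - of_real t * c))) = 0"
proof -
  obtain \<rho> :: real where \<rho>: "\<rho> \<noteq> 0" "a + c - b - d = of_real \<rho> * s" by (rule axis_multiple)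
  then show ?thesis
    unfolding isogonal_form_focal \<rho>(2) mult.assoc Im_of_real_mult by simp
qed

lemma conjugate_minus_vertex:
  assumes "w \<noteq> of_real t * f"
  shows "of_real t * m / (w - of_real t * f) - (a - f) =
      - (a - f) * (w - of_real t * c) / (w - of_real t * f)"
    and "of_real t * m / (w - of_real t * f) - (c - f) =
      - (c - f) * (w - of_real t * a) / (w - of_real t * f)"
  using assms by (simp_all add: ac[symmetric] field_simps)

lemma isogonal_form_focal_conjugate:
  assumes "isogonal_form a b c d v = 0"
  shows "isogonal_form a b c d (focal_conjugate f m s v) = 0"
proof (cases "fst v = of_real (snd v) * f")
  case True
  then have "focal_conjugate f m s v = (s, 0)" by (simp add: focal_conjugate_def)
  then show ?thesis using axis by (simp only: isogonal_form_at_infinity)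
next
  case False
  obtain w t where v: "v = (w, t)" by (cases v)
  define z where "z = w - of_real t * f"
  have w: "w \<noteq> of_real t * f" and z: "z \<noteq> 0" using False by (simp_all add: v z_def)
  define q where "q = (w - of_real t * a) * (w - of_real t * c)"
  have shift: "f + x - of_real 1 * u = x - (u - f)" for x u by simp
  have "(of_real t * m / z - (a - f)) * (of_real t * m / z - (c - f)) = m * q / z\<^sup>2"
    unfolding z_def conjugate_minus_vertex[OF w]
    by (simp add: q_def ac[symmetric] power2_eq_square) (simp add: algebra_simps)
  moreover have "focal_conjugate f m s v = (f + of_real t * m / z, 1)"
    using False by (simp add: v z_def focal_conjugate_def)
  ultimately have "isogonal_form a b c d (focal_conjugate f m s v) =
      Im ((a + c - b - d) * (of_real t * m / z) * cnj (m * q / z\<^sup>2))"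
    by (simp only: isogonal_form_focal shift diff_self diff_0_right)
  also have "(a + c - b - d) * (of_real t * m / z) * cnj (m * q / z\<^sup>2) =
      of_real (t * (cmod m)\<^sup>2 / (cmod z) ^ 4) * ((a + c - b - d) * z * cnj q)"
    unfolding of_real_mult of_real_divide complex_norm_square of_real_cmod_power4 using z
    by (simp add: power2_eq_square field_simps)
  also have "Im \<dots> = t * (cmod m)\<^sup>2 / (cmod z) ^ 4 * isogonal_form a b c d v"
    by (simp only: v isogonal_form_focal z_def q_def Im_of_real_mult)
  finally show ?thesis using assms by simp
qed

lemma isogonal_at_vertex_iff:
  "isogonal_at_vertex a b c d v v' \<longleftrightarrow>
     Im (vertex_dir a b c d v * vertex_dir a b c d v' * cnj ((a - f) * s)) = 0"
proof -
  obtain \<rho> :: real where \<rho>: "\<rho> \<noteq> 0" "a + c - b - d = of_real \<rho> * s" by (rule axis_multiple)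
  have "u * cnj ((b - a) * (d - a)) = of_real \<rho> * (u * cnj ((a - f) * s))" for u
    by (simp add: adjacent_product \<rho>(2))
  then have "Im (u * cnj ((b - a) * (d - a))) = \<rho> * Im (u * cnj ((a - f) * s))" for u
    by (simp only: Im_of_real_mult)
  then show ?thesis using \<rho>(1) by (simp only: isogonal_at_vertex_def mult_eq_0_iff) simp
qed

lemma isogonal_at_vertex_opposite:
  assumes "t \<noteq> 0" "t' \<noteq> 0"
  shows "isogonal_at_vertex a b c d (of_real t * a, t) (of_real t' * c, t')"
proof -
  have "a \<noteq> c" using quad by (auto simp: quadrilateral_def)
  define p where "p = (b - a) * (d - a)"
  have "p * cnj (a - c) * (of_real t' * (c - a)) * cnj p =
      - of_real (t' * (cmod p)\<^sup>2 * (cmod (a - c))\<^sup>2)"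
    unfolding of_real_mult complex_norm_square by (simp add: algebra_simps)
  then have "Im (p * cnj (a - c) * (of_real t' * (c - a)) * cnj p) = 0"
    by (simp only: uminus_complex.sel Im_complex_of_real)
  moreover have "vertex_dir a b c d (of_real t * a, t) = p * cnj (a - c)"
    "vertex_dir a b c d (of_real t' * c, t') = of_real t' * (c - a)"
    using assms \<open>a \<noteq> c\<close> by (simp_all add: vertex_dir_def p_def algebra_simps)
  ultimately show ?thesis by (simp only: isogonal_at_vertex_def p_def)
qed

lemma isogonal_at_vertex_focal_conjugate_generic:
  assumes on: "isogonal_form a b c d (w, t) = 0"
    and generic: "w \<noteq> of_real t * f" "w \<noteq> of_real t * a" "w \<noteq> of_real t * c"
  shows "isogonal_at_vertex a b c d (w, t) (focal_conjugate f m s (w, t))"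
proof -
  define z where "z = w - of_real t * f"
  define q where "q = (w - of_real t * a) * (w - of_real t * c)"
  have z: "z \<noteq> 0" using generic by (simp add: z_def)
  have "f + of_real t * m / z \<noteq> a"
    using conjugate_minus_vertex(1)[OF generic(1)] generic vertex_ne_focus z
    by (auto simp: z_def)
  then have "isogonal_at_vertex a b c d (w, t) (focal_conjugate f m s (w, t)) \<longleftrightarrow>
      Im ((w - of_real t * a) * (of_real t * m / z - (a - f)) * cnj ((a - f) * s)) = 0"
    using generic
    by (simp add: isogonal_at_vertex_iff vertex_dir_def focal_conjugate_def z_def algebra_simps)
  also have "(w - of_real t * a) * (of_real t * m / z - (a - f)) * cnj ((a - f) * s) =
      - of_real ((cmod (a - f))\<^sup>2 / (cmod z)\<^sup>2) * cnj (s * z * cnj q)"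
    unfolding z_def conjugate_minus_vertex(1)[OF generic(1)]
    unfolding of_real_divide complex_norm_square z_def[symmetric] q_def
    using z by (simp add: field_simps)
  also have "Im \<dots> = (cmod (a - f))\<^sup>2 / (cmod z)\<^sup>2 * Im (s * z * cnj q)"
    by (simp only: times_complex.sel(2) uminus_complex.sel Im_complex_of_real Re_complex_of_real
        cnj.sel)
  also have "\<dots> = 0" using on by (simp add: isogonal_form_eq_0_iff z_def q_def)
  finally show ?thesis by simp
qed

lemma isogonal_at_vertex_focus:
  assumes "t \<noteq> 0"
  shows "isogonal_at_vertex a b c d (of_real t * f, t) (s, 0)"
proof -
  have "vertex_dir a b c d (of_real t * f, t) * vertex_dir a b c d (s, 0) =
      - of_real t * ((a - f) * s)"
    using assms vertex_ne_focus axis_nonzero by (simp add: vertex_dir_def algebra_simps)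
  moreover have "Im (- of_real t * p * cnj p) = 0" for p by simp
  ultimately show ?thesis by (simp only: isogonal_at_vertex_iff)
qed

lemma isogonal_at_vertex_focal_conjugate:
  assumes "v \<noteq> 0" "isogonal_form a b c d v = 0"
  shows "isogonal_at_vertex a b c d v (focal_conjugate f m s v)"
proof -
  obtain w t where v: "v = (w, t)" by (cases v)
  have t: "t \<noteq> 0" if "w = of_real t * u" for u using assms(1) that by (auto simp: v zero_prod_def)
  consider (focus) "w = of_real t * f" | (vertex) "w = of_real t * a"
    | (opposite) "w = of_real t * c"
    | (generic) "w \<noteq> of_real t * f" "w \<noteq> of_real t * a" "w \<noteq> of_real t * c"
    by blast
  then show ?thesis
  proof cases
    case focus
    then show ?thesis
      using isogonal_at_vertex_focus[OF t[OF focus]] by (simp add: v focal_conjugate_def)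
  next
    case vertex
    have "focal_conjugate f m s v = (c, 1)"
      using t[OF vertex] vertex_ne_focus
      by (simp add: v vertex focal_conjugate_def ac[symmetric] right_diff_distrib[symmetric])
    then show ?thesis
      using isogonal_at_vertex_opposite[OF t[OF vertex], of 1] by (simp add: v vertex)
  next
    case opposite
    have "focal_conjugate f m s v = (a, 1)"
      using t[OF opposite] vertex_ne_focus
      by (simp add: v opposite focal_conjugate_def ac[symmetric] right_diff_distrib[symmetric])
    then show ?thesis using isogonal_at_vertex_opposite[of 1 t] t[OF opposite]
      by (simp add: v opposite isogonal_at_vertex_sym)
  next
    case generic
    then show ?thesis using isogonal_at_vertex_focal_conjugate_generic assms(2) by (simp add: v)
  qed
qed

lemma isogonal_conjugates_focal_conjugate:
  assumes v: "v \<noteq> 0" "span {v} \<in> isogonal_cubic a b c d"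
  shows "isogonal_conjugates a b c d (span {v}) (span {focal_conjugate f m s v})"
proof -
  interpret b: focal_quadrilateral b c d a f m s by (rule rotate)
  interpret c: focal_quadrilateral c d a b f m s by (rule b.rotate)
  interpret d: focal_quadrilateral d a b c f m s by (rule c.rotate)
  have "isogonal_form a b c d v = 0" using v by (simp add: span_in_isogonal_cubic)
  then have "isogonal_form b c d a v = 0" "isogonal_form c d a b v = 0" "isogonal_form d a b c v = 0"
    by (simp_all add: isogonal_form_rotate[of b c d a] isogonal_form_rotate[of c d a b]
        isogonal_form_rotate[of d a b c])
  then show ?thesis
    using v \<open>isogonal_form a b c d v = 0\<close> focal_conjugate_nonzero[OF axis_nonzero]
    by (simp add: isogonal_conjugates_iff quad isogonal_at_vertex_focal_conjugate
        b.isogonal_at_vertex_focal_conjugate c.isogonal_at_vertex_focal_conjugate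
        d.isogonal_at_vertex_focal_conjugate)
qed

lemma focal_conjugate_in_isogonal_cubic:
  assumes "v \<noteq> 0" "span {v} \<in> isogonal_cubic a b c d"
  shows "span {focal_conjugate f m s v} \<in> isogonal_cubic a b c d"
  using assms isogonal_form_focal_conjugate focal_conjugate_nonzero[OF axis_nonzero]
  by (simp add: span_in_isogonal_cubic)

definition asymptote_height :: real where
  "asymptote_height = Im ((a + c - 2 * f) / s)"

lemma isogonal_form_eq_0_iff_circular_form:
  "isogonal_form a b c d (of_real t * f + s * z, t) = 0 \<longleftrightarrow>
     circular_form asymptote_height (m / s\<^sup>2) (z, t) = 0"
proof -
  obtain \<rho> :: real where \<rho>: "\<rho> \<noteq> 0" "a + c - b - d = of_real \<rho> * s" by (rule axis_multiple)
  define e where "e = (a + c - 2 * f) / s"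
  define n where "n = m / s\<^sup>2"
  have e: "a + c - 2 * f = e * s" and n: "m = n * s\<^sup>2"
    using axis_nonzero by (auto simp: e_def n_def)
  define q where "q = z\<^sup>2 - of_real t * e * z + (of_real t)\<^sup>2 * n"
  have "(of_real t * f + s * z - of_real t * a) * (of_real t * f + s * z - of_real t * c) =
      (s * z)\<^sup>2 - of_real t * (a + c - 2 * f) * (s * z) + (of_real t)\<^sup>2 * m"
    by (simp add: ac[symmetric] power2_eq_square algebra_simps)
  also have "\<dots> = s\<^sup>2 * q"
    unfolding e n q_def by (simp add: power2_eq_square algebra_simps)
  finally have "isogonal_form a b c d (of_real t * f + s * z, t) =
      Im (of_real \<rho> * s * (s * z) * cnj (s\<^sup>2 * q))"
    by (simp only: isogonal_form_focal \<rho>(2) add_diff_cancel_left')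
  also have "of_real \<rho> * s * (s * z) * cnj (s\<^sup>2 * q) = of_real (\<rho> * (cmod s) ^ 4) * (z * cnj q)"
    unfolding of_real_mult of_real_cmod_power4 by (simp add: power2_eq_square)
  also have "Im \<dots> = \<rho> * (cmod s) ^ 4 * Im (z * cnj q)" by (rule Im_of_real_mult)
  also have "Im (z * cnj q) = - circular_form asymptote_height n (z, t)"
    unfolding circular_form_def cmod_power2 q_def asymptote_height_def e_def[symmetric]
    by (simp add: power2_eq_square algebra_simps)
  finally show ?thesis using \<rho>(1) axis_nonzero by (simp add: n_def)
qed

lemma circular_form_nondegenerate:
  assumes "\<not> contains_line (isogonal_cubic a b c d)"
  shows "Im (m / s\<^sup>2) \<noteq> 0 \<or> asymptote_height * Re (m / s\<^sup>2) \<noteq> 0"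
proof (rule ccontr)
  assume "\<not> ?thesis"
  then obtain x where x: "\<And>z t. Im z = x * t \<Longrightarrow>
      circular_form asymptote_height (m / s\<^sup>2) (z, t) = 0"
    using degenerate_circular_form_vanishes_on_line by blast
  define r where "r = 1 / s"
  define \<phi> where "\<phi> v = Im ((fst v - of_real (snd v) * f) * r) - x * snd v"
    for v :: "complex \<times> real"
  have "contains_line (isogonal_cubic a b c d)"
  proof (rule contains_lineI)
    show "linear \<phi>"
      by (rule linearI) (simp_all add: \<phi>_def algebra_simps)
    show "\<phi> (s * \<i>, 0) \<noteq> 0" using axis_nonzero by (simp add: \<phi>_def r_def)
    show "span {v} \<in> isogonal_cubic a b c d" if "v \<noteq> 0" "\<phi> v = 0" for v
    proof -
      define z where "z = (fst v - of_real (snd v) * f) / s"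
      have "v = (of_real (snd v) * f + s * z, snd v)" using axis_nonzero by (simp add: z_def)
      moreover have "Im z = x * snd v" using that(2) by (simp add: \<phi>_def z_def r_def)
      ultimately have "isogonal_form a b c d v = 0"
        using x isogonal_form_eq_0_iff_circular_form by metis
      then show ?thesis using that(1) by (simp add: span_in_isogonal_cubic)
    qed
  qed
  then show False using assms by contradiction
qed

end

lemma ex_focal_quadrilateral:
  assumes "quadrilateral a b c d" "\<not> contains_line (isogonal_cubic a b c d)"
  obtains f m s where "focal_quadrilateral a b c d f m s"
proof -
  define s where "s = a + c - b - d"
  define f where "f = (a * c - b * d) / s"
  have "a + c \<noteq> b + d" using assms(2) parallelogram_contains_line by blast
  then have s: "s \<noteq> 0" by (simp add: s_def algebra_simps)
  then have "f * (a + c - b - d) = a * c - b * d" by (simp add: f_def s_def)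
  then have "(b - f) * (d - f) = (a - f) * (c - f)" by algebra
  then have "focal_quadrilateral a b c d f ((a - f) * (c - f)) s"
    using assms(1) \<open>a + c \<noteq> b + d\<close> s by (simp add: focal_quadrilateral_def s_def[symmetric])
  then show ?thesis by (rule that)
qed

lemma focal_data_unique:
  assumes "focal_quadrilateral a b c d f m s" "focal_quadrilateral a' b' c' d' f' m' s"
    and K: "isogonal_cubic a' b' c' d' = isogonal_cubic a b c d"
    and no_line: "\<not> contains_line (isogonal_cubic a b c d)"
  shows "f' = f" "m' = m"
proof -
  interpret Q: focal_quadrilateral a b c d f m s by fact
  interpret Q': focal_quadrilateral a' b' c' d' f' m' s by fact
  define g where "g = (f' - f) / s"
  have same: "isogonal_form a' b' c' d' (w, 1) = 0" if "isogonal_form a b c d (w, 1) = 0" for w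
    using that K span_in_isogonal_cubic[of "(w, 1)"] by (metis snd_conv snd_zero zero_neq_one)
  have "circular_form Q'.asymptote_height (m' / s\<^sup>2) (z - g, 1) = 0"
    if "circular_form Q.asymptote_height (m / s\<^sup>2) (z, 1) = 0" for z
  proof -
    have "isogonal_form a' b' c' d' (f + s * z, 1) = 0"
      using that Q.isogonal_form_eq_0_iff_circular_form[of 1 z] by (intro same) simp
    moreover have "f + s * z = of_real 1 * f' + s * (z - g)"
      using Q.axis_nonzero by (simp add: g_def field_simps)
    ultimately show ?thesis using Q'.isogonal_form_eq_0_iff_circular_form[of 1 "z - g"] by metis
  qed
  note unique = circular_form_unique[OF Q.circular_form_nondegenerate[OF no_line] this]
  show "f' = f" "m' = m" using Q.axis_nonzero unique by (auto simp: g_def)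
qed

lemma focal_quadrilateral_same_cubic:
  assumes Q: "focal_quadrilateral a b c d f m s"
    and q': "quadrilateral a' b' c' d'" "isogonal_cubic a' b' c' d' = isogonal_cubic a b c d"
    and no_line: "\<not> contains_line (isogonal_cubic a b c d)"
  shows "focal_quadrilateral a' b' c' d' f m s"
proof -
  interpret Q: focal_quadrilateral a b c d f m s by fact
  obtain f' m' s' where "focal_quadrilateral a' b' c' d' f' m' s'"
    using ex_focal_quadrilateral q' no_line by metis
  then interpret Q': focal_quadrilateral a' b' c' d' f' m' s' .
  have at_infinity: "span {(s, 0)} \<in> isogonal_cubic a b c d \<longleftrightarrow> Im ((a + c - b - d) * cnj s) = 0"
    for a b c d
    using Q.axis_nonzero
    by (simp add: span_in_isogonal_cubic isogonal_form_at_infinity zero_prod_def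
        del: minus_complex.sel times_complex.sel)
  then have "Im ((a' + c' - b' - d') * cnj s) = 0" using Q.axis q'(2) by metis
  then have "focal_quadrilateral a' b' c' d' f' m' s"
    using Q'.quad Q'.not_parallelogram Q'.ac Q'.bd Q.axis_nonzero by unfold_locales
  then show ?thesis using focal_data_unique[OF Q _ q'(2) no_line] by metis
qed

theorem theorem7p2:
  fixes K :: "(complex \<times> real) set set"
    and a b c d a\<^sub>1 b\<^sub>1 c\<^sub>1 d\<^sub>1 :: complex
    and X :: "(complex \<times> real) set"
  assumes "nondegenerate_cubic K"
    and "quadrilateral a b c d" and "K = isogonal_cubic a b c d"
    and "quadrilateral a\<^sub>1 b\<^sub>1 c\<^sub>1 d\<^sub>1" and "K = isogonal_cubic a\<^sub>1 b\<^sub>1 c\<^sub>1 d\<^sub>1"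
    and "X \<in> K"
  shows "\<exists>X'\<in>K. (\<forall>Y. isogonal_conjugates a b c d X Y \<longleftrightarrow> Y = X') \<and>
                 (\<forall>Y. isogonal_conjugates a\<^sub>1 b\<^sub>1 c\<^sub>1 d\<^sub>1 X Y \<longleftrightarrow> Y = X')"
proof -
  have no_line: "\<not> contains_line K"
    using assms(1) irreducible_form_contains_no_line[of 3] by (auto simp: nondegenerate_cubic_def)
  obtain f m s where Q: "focal_quadrilateral a b c d f m s"
    using ex_focal_quadrilateral assms(2,3) no_line by metis
  have Q\<^sub>1: "focal_quadrilateral a\<^sub>1 b\<^sub>1 c\<^sub>1 d\<^sub>1 f m s"
    using focal_quadrilateral_same_cubic[OF Q] assms(3-5) no_line by metis
  obtain v where v: "v \<noteq> 0" "X = span {v}"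
    using assms(3,6) by (auto simp: isogonal_cubic_def zero_locus_def mem_RP2_iff)
  define X' where "X' = span {focal_conjugate f m s v}"
  have "X' \<in> K" "isogonal_conjugates a b c d X X'"
    using focal_quadrilateral.focal_conjugate_in_isogonal_cubic[OF Q v(1)]
      focal_quadrilateral.isogonal_conjugates_focal_conjugate[OF Q v(1)] assms(3,6)
    by (simp_all add: X'_def v(2))
  moreover have "isogonal_conjugates a\<^sub>1 b\<^sub>1 c\<^sub>1 d\<^sub>1 X X'"
    using focal_quadrilateral.isogonal_conjugates_focal_conjugate[OF Q\<^sub>1 v(1)] assms(5,6)
    by (simp add: X'_def v(2))
  ultimately show ?thesis
    using isogonal_conjugate_unique assms(2-5) no_line by metis
qed

end
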